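(* Let $\mathcal{T}=\mathcal{T}(O)$ be a self-similar tiling in $\mathbb{R}^d$ (generated on a feasible open set $O$ of an IFS with contraction ratios $r_1,\dots,r_N$ and similarity dimension $D$) with $D>d-1$. Assume that the generator $G$, with inradius $g$, is pluriphase, with partition $0=\varepsilon_0<\varepsilon_1<\dots<\varepsilon_m=g$ and coefficients $\kappa_k^\ell(G)$, $k=0,\dots,d-1$, $\ell=1,\dots,m$. Then the average Minkowski content of $\mathcal{T}$ is given by $$\widetilde{\mathcal{M}}^D(\mathcal{T})=\frac1\eta\sum_{k=0}^{d-1}\frac1{D-k}\left(\sum_{\ell=1}^{m-1}\bigl(\kappa_k^\ell(G)-\kappa_k^{\ell+1}(G)\bigr)\varepsilon_\ell^{D-k}+\frac{d-k}{d-D}\,\kappa_k^m(G)\,g^{D-k}\right),\qquad \eta=-\sum_{i=1}^N r_i^D\ln r_i .$$ In the nonlattice case, also the Minkowski content $\mathcal{M}^D(\mathcal{T})$ of $\mathcal{T}$ is given by the same expression.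
   Context: Setting. $N\ge2$, $S_1,\dots,S_N:\mathbb{R}^d\to\mathbb{R}^d$ are contracting similarities with ratios $r_i\in(0,1)$ (an IFS), and $\mathbf{S}(A):=\bigcup_{i=1}^N S_i(A)$. The similarity dimension $D$ is the unique real solution of $\sum_{i=1}^N r_i^D=1$. A feasible open set for the IFS is a nonempty bounded open set $O\subset\mathbb{R}^d$ with $S_iO\subset O$ for all $i$ and $S_iO\cap S_jO=\emptyset$ for $i\ne j$. The nonlattice case is the one where the additive subgroup of $\mathbb{R}$ generated by $\ln r_1,\dots,\ln r_N$ is not discrete. Tilings. Let $\Sigma_N^*=\bigcup_{n\ge0}\{1,\dots,N\}^n$, and for $\sigma=\sigma_1\cdots\sigma_n$ put $S_\sigma:=S_{\sigma_1}\circ\dots\circ S_{\sigma_n}$ (identity for the empty word). For a feasible open set $O$ let $K:=\overline O$ and let the generator be the open set $G:=O\setminus\mathbf{S}K$ (not necessarily connected). The self-similar tiling generated on $O$ is $\mathcal{T}(O):=\{S_\sigma G:\sigma\in\Sigma_N^*\}$; its union set is $T:=\bigcup_{\sigma}S_\sigma G$. The tiling is only defined when $D<d$ (equivalently $G\neq\emptyset$), which is assumed. The inradius of $G$ is $g:=\sup\{d(x,\partial G):x\in G\}$. For a bounded open set $U$, $V(U,\varepsilon):=\lambda_d(\{x\in U: d(x,\partial U)\le\varepsilon\})$, $\lambda_d$ Lebesgue measure. $G$ is pluriphase if there are a partition $0=\varepsilon_0<\varepsilon_1<\dots<\varepsilon_m=g$ and real numbers $\kappa_k^\ell(G)$ with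 $V(G,\varepsilon)=\sum_{k=0}^{d-1}\kappa_k^\ell(G)\,\varepsilon^{d-k}$ for $\varepsilon_{\ell-1}<\varepsilon\le\varepsilon_\ell$, $\ell=1,\dots,m$. Minkowski contents of the tiling (whenever the limits exist): $\mathcal{M}^D(\mathcal{T}):=\lim_{\varepsilon\searrow0}\varepsilon^{D-d}V(T,\varepsilon)$ and $\widetilde{\mathcal{M}}^D(\mathcal{T}):=\lim_{\delta\searrow0}\frac1{|\ln\delta|}\int_\delta^1\varepsilon^{D-d}V(T,\varepsilon)\frac{d\varepsilon}{\varepsilon}$. *)

theory Defs
  imports "HOL-Analysis.Analysis" "HOL-Computational_Algebra.Group_Closure"
begin

text \<open>Throughout, \<open>\<real>\<^sup>d\<close> is a type of class \<^class>\<open>euclidean_space\<close> with \<open>d = DIM('a)\<close>, and the maps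
  \<open>S i\<close> and ratios \<open>r i\<close> are only relevant for indices \<open>i \<in> {1..N}\<close>.\<close>

definition similarity_with_ratio :: "('a::metric_space \<Rightarrow> 'a) \<Rightarrow> real \<Rightarrow> bool" where
  "similarity_with_ratio f c \<longleftrightarrow> (\<forall>x y. dist (f x) (f y) = c * dist x y)"

definition similarity_ifs :: "nat \<Rightarrow> (nat \<Rightarrow> 'a::metric_space \<Rightarrow> 'a) \<Rightarrow> (nat \<Rightarrow> real) \<Rightarrow> bool" where
  "similarity_ifs N S r \<longleftrightarrow>
     2 \<le> N \<and> (\<forall>i\<in>{1..N}. 0 < r i \<and> r i < 1 \<and> similarity_with_ratio (S i) (r i))"

definition ifs_image :: "nat \<Rightarrow> (nat \<Rightarrow> 'a \<Rightarrow> 'a) \<Rightarrow> 'a set \<Rightarrow> 'a set" where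
  "ifs_image N S A = (\<Union>i\<in>{1..N}. S i ` A)"

definition feasible_open_set ::
    "nat \<Rightarrow> (nat \<Rightarrow> 'a::metric_space \<Rightarrow> 'a) \<Rightarrow> 'a set \<Rightarrow> bool" where
  "feasible_open_set N S U \<longleftrightarrow>
     U \<noteq> {} \<and> bounded U \<and> open U \<and>
     (\<forall>i\<in>{1..N}. S i ` U \<subseteq> U) \<and>
     (\<forall>i\<in>{1..N}. \<forall>j\<in>{1..N}. i \<noteq> j \<longrightarrow> S i ` U \<inter> S j ` U = {})"

text \<open>\<open>group_closure A\<close> is the additive subgroup generated by \<open>A\<close>.\<close>

definition nonlattice :: "nat \<Rightarrow> (nat \<Rightarrow> real) \<Rightarrow> bool" where
  "nonlattice N r \<longleftrightarrow> \<not> discrete (group_closure ((\<lambda>i. ln (r i)) ` {1..N}))"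

primrec word_map :: "(nat \<Rightarrow> 'a \<Rightarrow> 'a) \<Rightarrow> nat list \<Rightarrow> 'a \<Rightarrow> 'a" where
  "word_map S [] = id"
| "word_map S (i # \<sigma>) = S i \<circ> word_map S \<sigma>"

definition generator ::
    "nat \<Rightarrow> (nat \<Rightarrow> 'a::topological_space \<Rightarrow> 'a) \<Rightarrow> 'a set \<Rightarrow> 'a set" where
  "generator N S U = U - ifs_image N S (closure U)"

definition self_similar_tiling ::
    "nat \<Rightarrow> (nat \<Rightarrow> 'a::topological_space \<Rightarrow> 'a) \<Rightarrow> 'a set \<Rightarrow> 'a set set" where
  "self_similar_tiling N S U = {word_map S \<sigma> ` generator N S U |\<sigma>. \<sigma> \<in> lists {1..N}}"

definition inradius :: "'a::metric_space set \<Rightarrow> real" where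
  "inradius U = (SUP x\<in>U. infdist x (frontier U))"

definition inner_parallel_volume :: "'a::euclidean_space set \<Rightarrow> real \<Rightarrow> real" where
  "inner_parallel_volume U \<epsilon> = measure lebesgue {x \<in> U. infdist x (frontier U) \<le> \<epsilon>}"

text \<open>\<open>pluriphase_with G m e \<kappa>\<close>: the set \<open>G\<close> is pluriphase, with partition \<open>0 = e 0 < \<dots> < e m = g\<close> and
  coefficients \<open>\<kappa> k l\<close>, the second index \<open>l\<close> being the superscript.\<close>

definition pluriphase_with ::
    "'a::euclidean_space set \<Rightarrow> nat \<Rightarrow> (nat \<Rightarrow> real) \<Rightarrow> (nat \<Rightarrow> nat \<Rightarrow> real) \<Rightarrow> bool" where
  "pluriphase_with G m e \<kappa> \<longleftrightarrow>
     1 \<le> m \<and> e 0 = 0 \<and> e m = inradius G \<and> strict_mono_on {0..m} e \<and>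
     (\<forall>l\<in>{1..m}. \<forall>\<epsilon>\<in>{e (l - 1)<..e l}.
        inner_parallel_volume G \<epsilon> = (\<Sum>k<DIM('a). \<kappa> k l * \<epsilon> ^ (DIM('a) - k)))"

text \<open>The contents are limits that need not exist, hence relations between a family of tiles and
  the value of the limit.\<close>

definition has_minkowski_content ::
    "real \<Rightarrow> 'a::euclidean_space set set \<Rightarrow> real \<Rightarrow> bool" where
  "has_minkowski_content D \<T> M \<longleftrightarrow>
     ((\<lambda>\<epsilon>. \<epsilon> powr (D - real DIM('a)) * inner_parallel_volume (\<Union>\<T>) \<epsilon>) \<longlongrightarrow> M) (at_right 0)"

definition has_average_minkowski_content ::
    "real \<Rightarrow> 'a::euclidean_space set set \<Rightarrow> real \<Rightarrow> bool" where
  "has_average_minkowski_content D \<T> M \<longleftrightarrow>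
     ((\<lambda>\<delta>. 1 / \<bar>ln \<delta>\<bar> *
        (LBINT \<epsilon>:{\<delta>..1}. \<epsilon> powr (D - real DIM('a)) * inner_parallel_volume (\<Union>\<T>) \<epsilon> / \<epsilon>))
      \<longlongrightarrow> M) (at_right 0)"

end

theory Submission
  imports Defs
begin

text \<open>Write \<open>T\<close> for the union of the tiles, \<open>G\<close> for the generator, \<open>V\<close> and \<open>v\<close> for their inner parallel
volumes, \<open>d = DIM('a)\<close> and \<open>c = d - D > 0\<close>. The union \<open>T\<close> is the disjoint union of the open sets
\<open>G\<close> and \<open>S i ` T\<close>, and a connected ball lying in a disjoint union of open sets lies in one of them.
Hence parallel volumes add up and scale:
\<open>V \<epsilon> = v \<epsilon> + (\<Sum>i. r i ^ d * V (\<epsilon> / r i))\<close> (\<open>tiling_parallel_volume_recursion\<close>).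

In the variable \<open>t = - ln \<epsilon>\<close> this is a renewal equation. It is used for the primitive
\<open>I t = \<integral> \<epsilon> powr (- c) * V \<epsilon> / \<epsilon>\<close> over \<open>\<epsilon> > exp (- t)\<close>, which satisfies
\<open>I t = J t + (\<Sum>i. r i powr D * I (t + ln (r i)))\<close>, where \<open>J\<close> is the same integral with \<open>v\<close> in place
of \<open>V\<close>. The weights \<open>r i powr D\<close> form a probability distribution on the steps \<open>- ln (r i)\<close>, with
mean \<open>\<eta>\<close>. For a pluriphase generator \<open>v\<close> is piecewise a polynomial in which every power of \<open>\<epsilon>\<close> is
at least the first, so, as \<open>D > d - 1\<close>, \<open>J\<close> converges to a limit \<open>C\<close> that can be computed phase by
phase; summation by parts turns it into \<open>\<eta>\<close> times the asserted value
(\<open>tail_integral_pluriphase_limit\<close>).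

It remains to see that \<open>I t / t\<close> tends to \<open>C / \<eta>\<close>, which is the average content, and in the
nonlattice case that \<open>I t - I (t - h)\<close> tends to \<open>h * C / \<eta>\<close> for every \<open>h > 0\<close>. After subtracting the
linear function \<open>C / \<eta> * t\<close> these become statements about a solution \<open>R\<close> of a renewal equation whose
inhomogeneity \<open>j\<close> tends to \<open>0\<close>. Such an \<open>R\<close> is sublinear by an induction along the steps
(\<open>renewal_growth_bound\<close>). For Blackwell's theorem, suppose that the increment
\<open>F t = R t - R (t - h)\<close> has a positive limit superior \<open>L\<close>. Since \<open>F t\<close> is, up to a small error, a
weighted mean of the values \<open>F (t - y i)\<close>, a sequence along which \<open>F\<close> tends to \<open>L\<close> keeps this
property when shifted by any sum of steps. In the nonlattice case these sums eventually become
arbitrarily dense, so \<open>F\<close> is close to \<open>L\<close> on arbitrarily long stretches, on which \<open>R\<close> grows faster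
than the growth bound permits. The content itself is then recovered from the increments of \<open>I\<close>,
because the monotonicity of \<open>V\<close> squeezes \<open>\<epsilon> powr (- c) * V \<epsilon>\<close> between difference quotients of \<open>I\<close>.\<close>

section \<open>Renewal equations with finitely many steps\<close>

locale step_distribution =
  fixes A :: "'i set" and p y :: "'i \<Rightarrow> real"
  assumes finite_A: "finite A"
    and p_pos: "\<And>i. i \<in> A \<Longrightarrow> 0 < p i"
    and p_sum: "(\<Sum>i\<in>A. p i) = 1"
    and y_pos: "\<And>i. i \<in> A \<Longrightarrow> 0 < y i"
begin

definition mean :: real where
  "mean = (\<Sum>i\<in>A. p i * y i)"

text \<open>The equation is imposed on the whole real line instead of prescribing initial data on a half-line.\<close>

definition renewal_solution :: "(real \<Rightarrow> real) \<Rightarrow> (real \<Rightarrow> real) \<Rightarrow> bool" where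
  "renewal_solution j R \<longleftrightarrow> (\<forall>t. R t = j t + (\<Sum>i\<in>A. p i * R (t - y i)))"

inductive_set step_semigroup :: "real set" where
  zero: "0 \<in> step_semigroup"
| step: "s \<in> step_semigroup \<Longrightarrow> i \<in> A \<Longrightarrow> s + y i \<in> step_semigroup"

lemma A_nonempty: "A \<noteq> {}"
  using p_sum by auto

lemma mean_pos: "0 < mean"
  unfolding mean_def using finite_A A_nonempty p_pos y_pos by (intro sum_pos) auto

lemma step_bounds:
  obtains a b where "0 < a" "\<And>i. i \<in> A \<Longrightarrow> a \<le> y i" "\<And>i. i \<in> A \<Longrightarrow> y i \<le> b"
proof (rule that[of "Min (y ` A)" "Max (y ` A)"])
  show "0 < Min (y ` A)"
    using finite_A A_nonempty y_pos by (subst Min_gr_iff) auto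
qed (use finite_A in auto)

lemma renewal_solution_D:
  "renewal_solution j R \<Longrightarrow> R t = j t + (\<Sum>i\<in>A. p i * R (t - y i))"
  unfolding renewal_solution_def by blast

lemma renewal_solution_uminus:
  "renewal_solution j R \<Longrightarrow> renewal_solution (\<lambda>t. - j t) (\<lambda>t. - R t)"
  unfolding renewal_solution_def
proof
  fix t
  assume R: "\<forall>t. R t = j t + (\<Sum>i\<in>A. p i * R (t - y i))"
  show "- R t = - j t + (\<Sum>i\<in>A. p i * - R (t - y i))"
    unfolding mult_minus_right sum_negf using R[rule_format, of t] by linarith
qed

lemma renewal_solution_increment:
  "renewal_solution j R \<Longrightarrow> renewal_solution (\<lambda>t. j t - j (t - a)) (\<lambda>t. R t - R (t - a))"
  unfolding renewal_solution_def
proof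
  fix t
  assume R: "\<forall>t. R t = j t + (\<Sum>i\<in>A. p i * R (t - y i))"
  show "R t - R (t - a) = j t - j (t - a) + (\<Sum>i\<in>A. p i * (R (t - y i) - R (t - y i - a)))"
  proof -
    have "(\<Sum>i\<in>A. p i * (R (t - y i) - R (t - y i - a)))
        = (\<Sum>i\<in>A. p i * R (t - y i)) - (\<Sum>i\<in>A. p i * R (t - a - y i))"
      by (simp add: right_diff_distrib sum_subtractf diff_diff_eq add.commute)
    then show ?thesis
      using R[rule_format, of t] R[rule_format, of "t - a"] by linarith
  qed
qed

text \<open>A linear function of slope \<open>c / mean\<close> solves the renewal equation with constant inhomogeneity \<open>c\<close>;
subtracting it reduces everything to inhomogeneities that vanish at infinity.\<close>

lemma renewal_solution_minus_linear:
  assumes "renewal_solution J I"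
  shows "renewal_solution (\<lambda>t. J t - c) (\<lambda>t. I t - c / mean * t)"
  unfolding renewal_solution_def
proof
  fix t
  have "(\<Sum>i\<in>A. p i * (q * (t - y i))) = q * (t * (\<Sum>i\<in>A. p i) - (\<Sum>i\<in>A. p i * y i))" for q
    by (simp add: sum_distrib_left sum_subtractf algebra_simps)
  then have "(\<Sum>i\<in>A. p i * (c / mean * (t - y i))) = c / mean * (t * (\<Sum>i\<in>A. p i) - mean)"
    by (simp only: mean_def)
  also have "\<dots> = c / mean * t - c"
    using mean_pos by (simp add: p_sum field_simps)
  finally show "I t - c / mean * t = J t - c + (\<Sum>i\<in>A. p i * (I (t - y i) - c / mean * (t - y i)))"
    unfolding right_diff_distrib[of "p _" "I _"] sum_subtractf
    using renewal_solution_D[OF assms, of t] by linarith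
qed

text \<open>Each application of the renewal equation costs at most \<open>\<epsilon>\<close> and moves the argument back by at least
\<open>a\<close>, so about \<open>(t - s) / a\<close> applications lead into the window \<open>{s - b..s}\<close>, which cannot be jumped
over because no step exceeds \<open>b\<close>. The coefficients being averages, no other loss occurs.\<close>

lemma renewal_growth_bound:
  assumes R: "renewal_solution j R"
    and a: "0 < a" "\<And>i. i \<in> A \<Longrightarrow> a \<le> y i" and b: "\<And>i. i \<in> A \<Longrightarrow> y i \<le> b"
    and j: "\<And>t. s \<le> t \<Longrightarrow> \<bar>j t\<bar> \<le> \<epsilon>"
    and K: "\<And>t. s - b \<le> t \<Longrightarrow> t \<le> s \<Longrightarrow> \<bar>R t\<bar> \<le> K"
    and st: "s \<le> t"
  shows "\<bar>R t\<bar> \<le> K + \<epsilon> * ((t - s) / a + 1)"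
proof -
  have eps: "0 \<le> \<epsilon>" using j[of s] by auto
  have b0: "0 \<le> b" using A_nonempty b y_pos by (meson all_not_in_conv less_le_trans less_imp_le)
  \<comment> \<open>The maximum makes the claim hold inside the initial window too, as needed when a step enters it.\<close>
  have main: "s - b \<le> t \<Longrightarrow> t \<le> s + real n * a \<Longrightarrow> \<bar>R t\<bar> \<le> K + \<epsilon> * max 0 ((t - s) / a + 1)" for n t
  proof (induction n arbitrary: t)
    case 0
    then show ?case using K[of t] eps by (simp add: add_increasing2)
  next
    case (Suc n)
    show ?case
    proof (cases "t \<le> s")
      case True
      then show ?thesis using K[of t] Suc.prems eps by (simp add: add_increasing2)
    next
      case False
      have pre: "\<bar>R (t - y i)\<bar> \<le> K + \<epsilon> * ((t - s) / a)" if i: "i \<in> A" for i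
      proof -
        have "\<bar>R (t - y i)\<bar> \<le> K + \<epsilon> * max 0 ((t - y i - s) / a + 1)"
          using Suc.prems False a(2)[OF i] b[OF i] by (intro Suc.IH) (auto simp: algebra_simps)
        moreover have "max 0 ((t - y i - s) / a + 1) \<le> (t - s) / a"
          using False a(1) a(2)[OF i] by (auto simp: field_simps)
        ultimately show ?thesis
          by (meson add_left_mono eps mult_left_mono order_trans)
      qed
      have "\<bar>R t\<bar> \<le> \<bar>j t\<bar> + (\<Sum>i\<in>A. \<bar>p i * R (t - y i)\<bar>)"
        unfolding renewal_solution_D[OF R, of t]
        by (rule order_trans[OF abs_triangle_ineq]) (simp add: sum_abs)
      also have "(\<Sum>i\<in>A. \<bar>p i * R (t - y i)\<bar>) \<le> (\<Sum>i\<in>A. p i * (K + \<epsilon> * ((t - s) / a)))"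
        using pre p_pos by (intro sum_mono) (simp add: abs_mult less_imp_le)
      also have "\<dots> = K + \<epsilon> * ((t - s) / a)"
        by (simp add: sum_distrib_right[symmetric] p_sum)
      also have "\<bar>j t\<bar> \<le> \<epsilon>" using j False by auto
      finally show ?thesis using False a(1) by (simp add: algebra_simps)
    qed
  qed
  obtain n where n: "(t - s) / a \<le> real n" using real_arch_simple by blast
  have "\<bar>R t\<bar> \<le> K + \<epsilon> * max 0 ((t - s) / a + 1)"
    by (rule main[of _ n]) (use n a(1) st b0 in \<open>auto simp: field_simps\<close>)
  then show ?thesis using st a(1) by simp
qed

lemma renewal_sublinear:
  assumes R: "renewal_solution j R" and j: "(j \<longlongrightarrow> 0) at_top"
    and bdd: "\<And>u v. bounded (R ` {u..v})"
  shows "((\<lambda>t. R t / t) \<longlongrightarrow> 0) at_top"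
proof (rule tendstoI)
  fix \<epsilon> :: real assume "0 < \<epsilon>"
  obtain a b where ab: "0 < a" "\<And>i. i \<in> A \<Longrightarrow> a \<le> y i" "\<And>i. i \<in> A \<Longrightarrow> y i \<le> b"
    using step_bounds by blast
  define \<epsilon>' where "\<epsilon>' = \<epsilon> * a / 2"
  have e': "0 < \<epsilon>'" using \<open>0 < \<epsilon>\<close> ab(1) by (simp add: \<epsilon>'_def)
  from tendstoD[OF j e'] obtain s0 where s0: "\<And>t. s0 \<le> t \<Longrightarrow> \<bar>j t\<bar> < \<epsilon>'"
    by (auto simp: eventually_at_top_linorder)
  define s where "s = max s0 1"
  obtain K where K: "\<And>t. s - b \<le> t \<Longrightarrow> t \<le> s \<Longrightarrow> \<bar>R t\<bar> \<le> K"
    using bdd[of "s - b" s] by (force simp: bounded_iff)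
  have "eventually (\<lambda>t. max s (2 * (K + \<epsilon>') / \<epsilon>) < t) at_top"
    by (rule eventually_gt_at_top)
  then show "eventually (\<lambda>t. dist (R t / t) 0 < \<epsilon>) at_top"
  proof eventually_elim
    case (elim t)
    have t: "1 \<le> s" "s < t" "K + \<epsilon>' < \<epsilon> / 2 * t" using elim \<open>0 < \<epsilon>\<close> by (auto simp: s_def field_simps)
    have "\<bar>R t\<bar> \<le> K + \<epsilon>' * ((t - s) / a + 1)"
      by (rule renewal_growth_bound[OF R ab])
         (use s0 K t in \<open>auto simp: s_def intro!: less_imp_le[OF s0]\<close>)
    also have "\<dots> = K + \<epsilon>' + \<epsilon> / 2 * (t - s)" using ab(1) by (simp add: \<epsilon>'_def field_simps)
    also have "\<dots> < \<epsilon> / 2 * t + \<epsilon> / 2 * t" using t \<open>0 < \<epsilon>\<close> by (intro add_strict_mono) auto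
    finally show ?case using t by (simp add: field_simps)
  qed
qed

lemma step_semigroup_add: "u \<in> step_semigroup \<Longrightarrow> v \<in> step_semigroup \<Longrightarrow> u + v \<in> step_semigroup"
proof -
  assume u: "u \<in> step_semigroup"
  assume "v \<in> step_semigroup"
  then show ?thesis
  proof induction
    case zero
    then show ?case using u by simp
  next
    case (step s i)
    then show ?case using step_semigroup.step[of "u + s" i] by (simp add: add.assoc)
  qed
qed

lemma step_semigroup_mult: "u \<in> step_semigroup \<Longrightarrow> real n * u \<in> step_semigroup"
  by (induction n) (auto simp: algebra_simps intro: step_semigroup.zero step_semigroup_add)

lemma group_closure_differences:
  "g \<in> group_closure (y ` A) \<Longrightarrow> \<exists>u\<in>step_semigroup. \<exists>v\<in>step_semigroup. g = u - v"
proof (induction rule: group_closure.induct)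
  case (base s)
  then consider "s = 0" | i where "i \<in> A" "s = y i" by auto
  then show ?case
  proof cases
    case 2
    then show ?thesis using step_semigroup.step[OF step_semigroup.zero] step_semigroup.zero by force
  qed (use step_semigroup.zero in force)
next
  case (diff s t)
  then obtain u v u' v' where "u \<in> step_semigroup" "v \<in> step_semigroup" "u' \<in> step_semigroup" "v' \<in> step_semigroup"
    "s = u - v" "t = u' - v'" by blast
  then show ?case
    by (intro bexI[of _ "u + v'"] bexI[of _ "v + u'"] step_semigroup_add) auto
qed

text \<open>A nondiscrete group contains elements \<open>g\<close> in every interval \<open>{0<..<\<delta>}\<close>, and \<open>g\<close> is a difference of two
semigroup elements, say of \<open>\<beta> + g\<close> and \<open>\<beta>\<close>. Then \<open>k * \<beta> + j * g = (k - j) * \<beta> + j * (\<beta> + g)\<close> lies in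
the semigroup for \<open>j \<le> k\<close>, and once \<open>k * g \<ge> \<beta>\<close> these points fill the interval from \<open>k * \<beta>\<close> to
\<open>(k + 1) * \<beta>\<close> with gaps \<open>g\<close>.\<close>

lemma step_semigroup_asymptotically_dense:
  assumes nl: "\<not> discrete (group_closure (y ` A))" and \<delta>: "0 < \<delta>"
  obtains x0 where "\<And>x. x0 \<le> x \<Longrightarrow> \<exists>s\<in>step_semigroup. \<bar>x - s\<bar> \<le> \<delta>"
proof -
  obtain h where h: "h \<in> group_closure (y ` A)" "\<not> h isolated_in group_closure (y ` A)"
    using nl by (auto simp: discrete_def)
  then obtain h' where h': "h' \<in> group_closure (y ` A)" "h' \<noteq> h" "dist h h' < \<delta>"
    using \<delta> unfolding isolated_in_dist_Ex_iff by (auto simp: dist_commute)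
  have "\<bar>h' - h\<bar> \<in> group_closure (y ` A)"
    using group_closure.diff[OF h(1) h'(1)] group_closure.diff[OF h'(1) h(1)] by (auto simp: abs_if)
  then obtain u v where uv: "u \<in> step_semigroup" "v \<in> step_semigroup" "\<bar>h' - h\<bar> = u - v"
    using group_closure_differences by blast
  obtain i where i: "i \<in> A" using A_nonempty by auto
  have nn: "0 \<le> s" if "s \<in> step_semigroup" for s
    using that by induction (use y_pos in \<open>auto intro: add_nonneg_nonneg less_imp_le\<close>)
  \<comment> \<open>A common step is added to \<open>u\<close> and \<open>v\<close> to make the coarse spacing \<open>\<beta>\<close> nonzero.\<close>
  define \<beta> g where "\<beta> = v + y i" and "g = u - v"
  have beta: "\<beta> \<in> step_semigroup" "0 < \<beta>" and bg: "\<beta> + g \<in> step_semigroup"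
    using step_semigroup.step[OF uv(2) i] step_semigroup.step[OF uv(1) i] nn[OF uv(2)] y_pos[OF i]
    by (auto simp: \<beta>_def g_def add_nonneg_pos add.commute)
  have g: "0 < g" "g < \<delta>" using h' uv(3) by (auto simp: g_def dist_real_def)
  obtain k0 :: nat where k0: "\<beta> / g \<le> real k0" using real_arch_simple by blast
  show thesis
  proof (rule that)
    fix x assume x: "real k0 * \<beta> \<le> x"
    define k where "k = nat \<lfloor>x / \<beta>\<rfloor>"
    have x0: "0 \<le> x" using x beta by (meson less_imp_le mult_nonneg_nonneg of_nat_0_le_iff order_trans)
    have kx: "real k * \<beta> \<le> x" "x < real k * \<beta> + \<beta>"
    proof -
      have "real k = of_int \<lfloor>x / \<beta>\<rfloor>" using x0 beta by (simp add: k_def)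
      then have "real k \<le> x / \<beta>" "x / \<beta> < real k + 1" by linarith+
      then show "real k * \<beta> \<le> x" "x < real k * \<beta> + \<beta>" using beta by (auto simp: field_simps)
    qed
    have "int k0 \<le> \<lfloor>x / \<beta>\<rfloor>"
      using x beta by (simp add: le_floor_iff field_simps)
    then have "real k0 \<le> real k" by (simp add: k_def)
    then have "real k0 * g \<le> real k * g" using g by (intro mult_right_mono) auto
    moreover have "\<beta> \<le> real k0 * g" using k0 g by (simp add: pos_divide_le_eq)
    ultimately have kg: "\<beta> \<le> real k * g" by linarith
    define j where "j = nat \<lfloor>(x - real k * \<beta>) / g\<rfloor>"
    have jx: "real j * g \<le> x - real k * \<beta>" "x - real k * \<beta> < real j * g + g"
    proof -
      have "real j = of_int \<lfloor>(x - real k * \<beta>) / g\<rfloor>" using kx g by (simp add: j_def)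
      then have "real j \<le> (x - real k * \<beta>) / g" "(x - real k * \<beta>) / g < real j + 1" by linarith+
      then show "real j * g \<le> x - real k * \<beta>" "x - real k * \<beta> < real j * g + g"
        using g by (auto simp: field_simps)
    qed
    have "real j * g < real k * g" using jx kx kg by linarith
    then have jk: "j \<le> k" using g by simp
    have "real (k - j) * \<beta> + real j * (\<beta> + g) \<in> step_semigroup"
      by (intro step_semigroup_add step_semigroup_mult beta bg)
    also have "real (k - j) * \<beta> + real j * (\<beta> + g) = real k * \<beta> + real j * g"
      using jk by (simp add: of_nat_diff algebra_simps)
    finally show "\<exists>s\<in>step_semigroup. \<bar>x - s\<bar> \<le> \<delta>"
      using jx g by (intro bexI) auto
  qed
qed

text \<open>\<open>F (t n - s)\<close> is almost a convex combination of values that are asymptotically at most \<open>L\<close>. If it is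
close to \<open>L\<close>, then every term with a fixed positive weight has to be close to \<open>L\<close>.\<close>

lemma maximizing_sequence_propagates:
  assumes F: "renewal_solution f F" and f: "(f \<longlongrightarrow> 0) at_top"
    and up: "\<And>\<epsilon>. 0 < \<epsilon> \<Longrightarrow> eventually (\<lambda>t. F t \<le> L + \<epsilon>) at_top"
    and t: "filterlim t at_top sequentially" and Ft: "(\<lambda>n. F (t n)) \<longlonglongrightarrow> L"
    and s: "s \<in> step_semigroup"
  shows "(\<lambda>n. F (t n - s)) \<longlonglongrightarrow> L"
  using s
proof induction
  case zero
  then show ?case using Ft by simp
next
  case (step s i)
  have shift: "filterlim (\<lambda>n. t n - c) at_top sequentially" for c
    using filterlim_tendsto_add_at_top[OF tendsto_const[of "-c"] t] by simp
  show ?case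
  proof (rule tendstoI)
    fix \<epsilon> :: real assume "0 < \<epsilon>"
    \<comment> \<open>Three errors of size \<open>\<epsilon>'\<close> are divided by the weight \<open>p i\<close> and must stay below \<open>\<epsilon>\<close>.\<close>
    define \<epsilon>' where "\<epsilon>' = p i * \<epsilon> / 4"
    have e': "0 < \<epsilon>'" using \<open>0 < \<epsilon>\<close> p_pos step by (simp add: \<epsilon>'_def)
    have pi1: "p i \<le> 1"
      using sum_mono2[OF finite_A, of "{i}" p] p_sum p_pos step by (auto intro: less_imp_le)
    have "eventually (\<lambda>n. dist (F (t n - s)) L < \<epsilon>') sequentially"
      using tendstoD[OF step.IH e'] .
    moreover have "eventually (\<lambda>n. \<bar>f (t n - s)\<bar> < \<epsilon>') sequentially"
      using eventually_compose_filterlim[OF tendstoD[OF f e'] shift[of s]] by simp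
    moreover have "eventually (\<lambda>n. \<forall>k\<in>A. F (t n - s - y k) \<le> L + \<epsilon>') sequentially"
      using finite_A eventually_compose_filterlim[OF up[OF e'] shift]
      by (intro eventually_ball_finite) (auto simp: diff_diff_eq)
    ultimately show "eventually (\<lambda>n. dist (F (t n - (s + y i))) L < \<epsilon>) sequentially"
    proof eventually_elim
      case (elim n)
      have Fs: "L - \<epsilon>' < F (t n - s)" and fs: "f (t n - s) < \<epsilon>'"
        using elim by (auto simp: dist_real_def abs_less_iff)
      have "(\<Sum>k\<in>A - {i}. p k * F (t n - s - y k)) \<le> (\<Sum>k\<in>A - {i}. p k * (L + \<epsilon>'))"
        using elim p_pos by (intro sum_mono mult_left_mono) (auto intro: less_imp_le)
      also have "\<dots> = (1 - p i) * (L + \<epsilon>')"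
        using p_sum finite_A step(2) by (simp add: sum_distrib_right[symmetric] sum_diff1)
      finally have "F (t n - s) \<le> f (t n - s) + p i * F (t n - s - y i) + (1 - p i) * (L + \<epsilon>')"
        using renewal_solution_D[OF F, of "t n - s"] finite_A step(2) by (simp add: sum.remove)
      then have "p i * (L - F (t n - s - y i)) < 2 * \<epsilon>' + (1 - p i) * \<epsilon>'"
        using Fs fs by (simp add: algebra_simps)
      also have "\<dots> \<le> 3 * \<epsilon>'" using e' p_pos[OF step(2)] by (simp add: algebra_simps)
      also have "\<dots> < p i * \<epsilon>" using \<open>0 < \<epsilon>\<close> p_pos[OF step(2)] by (simp add: \<epsilon>'_def)
      finally have "L - F (t n - s - y i) < \<epsilon>" using p_pos[OF step(2)] by simp
      moreover have "F (t n - s - y i) \<le> L + \<epsilon>'" using elim step(2) by auto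
      moreover have "\<epsilon>' < \<epsilon>"
      proof -
        have "\<epsilon>' \<le> 1 * \<epsilon> / 4" unfolding \<epsilon>'_def
          using pi1 \<open>0 < \<epsilon>\<close> by (intro divide_right_mono mult_right_mono) auto
        then show ?thesis using \<open>0 < \<epsilon>\<close> by simp
      qed
      ultimately show ?case by (simp add: dist_real_def diff_diff_eq abs_less_iff)
    qed
  qed
qed

text \<open>Only the upper estimate is proved here; the lower one is the upper one for \<open>- R\<close>. A positive limit
superior \<open>L\<close> of the increments contradicts \<open>renewal_growth_bound\<close>, applied on a stretch of length
\<open>M * h\<close> to \<open>R\<close> minus its value at the left end of the stretch: with that normalization the initial
bound does not depend on \<open>M\<close>.\<close>

lemma renewal_increment_limsup_nonpos:
  assumes nl: "\<not> discrete (group_closure (y ` A))"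
    and R: "renewal_solution j R" and j: "(j \<longlongrightarrow> 0) at_top"
    and lip: "\<And>s t. \<bar>R s - R t\<bar> \<le> C * \<bar>s - t\<bar>"
    and h: "0 < h" and \<epsilon>: "0 < \<epsilon>"
  shows "eventually (\<lambda>t. R t - R (t - h) \<le> \<epsilon>) at_top"
proof -
  define F where "F = (\<lambda>t. R t - R (t - h))"
  define f where "f = (\<lambda>t. j t - j (t - h))"
  have F: "renewal_solution f F"
    unfolding F_def f_def by (rule renewal_solution_increment[OF R])
  have shift: "filterlim (\<lambda>t::real. t - c) at_top at_top" for c
    using filterlim_tendsto_add_at_top[OF tendsto_const[of "-c"] filterlim_ident] by simp
  have f: "(f \<longlongrightarrow> 0) at_top"
    unfolding f_def using tendsto_diff[OF j filterlim_compose[OF j shift]] by simp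
  have C: "0 \<le> C" using lip[of 0 1] by simp
  have Fbd: "\<bar>F t\<bar> \<le> C * h" for t using lip[of t "t - h"] h by (simp add: F_def)
  have Flip: "\<bar>F s - F t\<bar> \<le> 2 * C * \<bar>s - t\<bar>" for s t
  proof -
    have "\<bar>F s - F t\<bar> = \<bar>(R s - R t) - (R (s - h) - R (t - h))\<bar>" by (simp add: F_def)
    also have "\<dots> \<le> \<bar>R s - R t\<bar> + \<bar>R (s - h) - R (t - h)\<bar>" by (rule abs_triangle_ineq4)
    also have "\<dots> \<le> 2 * C * \<bar>s - t\<bar>" using add_mono[OF lip[of s t] lip[of "s - h" "t - h"]] by simp
    finally show ?thesis .
  qed
  define Bs where "Bs = {l. eventually (\<lambda>t. F t \<le> l) at_top}"
  define L where "L = Inf Bs"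
  have "F t \<le> C * h" for t using Fbd[of t] by linarith
  then have Bs: "C * h \<in> Bs" by (simp add: Bs_def)
  have Bs_bdd: "bdd_below Bs"
  proof (rule bdd_belowI[of _ "- (C * h)"])
    fix l assume "l \<in> Bs"
    then obtain t where "F t \<le> l" by (auto simp: Bs_def eventually_at_top_linorder)
    then show "- (C * h) \<le> l" using Fbd[of t] by linarith
  qed
  have up: "eventually (\<lambda>t. F t \<le> L + \<mu>) at_top" if "0 < \<mu>" for \<mu>
  proof -
    have "L < L + \<mu>" using that by simp
    then obtain l where "l \<in> Bs" "l < L + \<mu>"
      unfolding L_def using cInf_lessD[of Bs] Bs by blast
    then show ?thesis by (auto simp: Bs_def elim!: eventually_mono)
  qed
  have low: "\<exists>t\<ge>X. L - \<mu> < F t" if "0 < \<mu>" for \<mu> X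
  proof (rule ccontr)
    assume "\<not> ?thesis"
    then have "L - \<mu> \<in> Bs" by (auto simp: Bs_def eventually_at_top_linorder not_less)
    then show False using cInf_lower[OF _ Bs_bdd] that unfolding L_def by force
  qed
  have "L \<le> 0"
  proof (rule ccontr)
    assume "\<not> L \<le> 0"
    then have L: "0 < L" by simp
    have "\<forall>n. \<exists>t\<ge>real n. L - 1 / real (Suc n) < F t" using low by auto
    then obtain t where t: "\<And>n. real n \<le> t n" "\<And>n. L - 1 / real (Suc n) < F (t n)" by metis
    have t_top: "filterlim t at_top sequentially"
      by (rule filterlim_at_top_mono[OF filterlim_real_sequentially]) (use t in auto)
    have Ft: "(\<lambda>n. F (t n)) \<longlonglongrightarrow> L"
    proof (rule tendstoI)
      fix \<mu> :: real assume mu: "0 < \<mu>"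
      have "eventually (\<lambda>n. F (t n) \<le> L + \<mu> / 2) sequentially"
        by (rule eventually_compose_filterlim[OF up t_top]) (use mu in auto)
      moreover have "eventually (\<lambda>n. 1 / real (Suc n) < \<mu>) sequentially"
        using order_tendstoD(2)[OF LIMSEQ_inverse_real_of_nat mu] by (simp add: inverse_eq_divide)
      ultimately show "eventually (\<lambda>n. dist (F (t n)) L < \<mu>) sequentially"
      proof eventually_elim
        case (elim n)
        then show ?case using t(2)[of n] mu by (simp add: dist_real_def abs_less_iff)
      qed
    qed
    obtain a b where ab: "0 < a" "\<And>i. i \<in> A \<Longrightarrow> a \<le> y i" "\<And>i. i \<in> A \<Longrightarrow> y i \<le> b"
      using step_bounds by blast
    \<comment> \<open>Moving the argument of \<open>F\<close> by \<open>\<delta>\<close> changes its value by at most \<open>L / 4\<close>.\<close>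
    define \<delta> where "\<delta> = L / (8 * (C + 1))"
    have dl: "0 < \<delta>" "2 * C * \<delta> \<le> L / 4" using L C by (auto simp: \<delta>_def field_simps)
    obtain x0 where x0: "\<And>x. x0 \<le> x \<Longrightarrow> \<exists>s\<in>step_semigroup. \<bar>x - s\<bar> \<le> \<delta>"
      using step_semigroup_asymptotically_dense[OF nl dl(1)] by blast
    define \<mu> where "\<mu> = L * a / (4 * h)"
    have mu: "0 < \<mu>" using L ab(1) h by (simp add: \<mu>_def)
    \<comment> \<open>The accumulated increment \<open>M * L / 2\<close> over \<open>M\<close> windows has to beat the growth bound
      \<open>C * b + \<mu> * (M * h / a + 1)\<close>, half of which \<open>\<mu>\<close> makes harmless.\<close>
    obtain M :: nat where M: "(C * b + \<mu>) * 4 / L < real M" using reals_Archimedean2 by blast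
    define H where "H = real M * h"
    define x1 where "x1 = max x0 0"
    \<comment> \<open>The \<open>\<sigma> k\<close> approximate the points of a progression with difference \<open>h\<close>, so that increments telescope.\<close>
    have "\<forall>k. \<exists>s\<in>step_semigroup. \<bar>x1 + real k * h - s\<bar> \<le> \<delta>"
      using x0 h by (simp add: x1_def max_def add_increasing2)
    then obtain \<sigma> where \<sigma>: "\<And>k. \<sigma> k \<in> step_semigroup" "\<And>k. \<bar>x1 + real k * h - \<sigma> k\<bar> \<le> \<delta>" by metis
    obtain s0 where s0: "\<And>t. s0 \<le> t \<Longrightarrow> \<bar>j t\<bar> < \<mu>"
      using tendstoD[OF j mu] by (auto simp: eventually_at_top_linorder)
    have "eventually (\<lambda>n. \<forall>k\<in>{..<M}. L - L / 4 < F (t n - \<sigma> k)) sequentially"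
      using L by (intro eventually_ball_finite ballI
          order_tendstoD(1)[OF maximizing_sequence_propagates[OF F f up t_top Ft \<sigma>(1)]]) auto
    moreover have "eventually (\<lambda>n. s0 + H + x1 \<le> t n) sequentially"
      using t_top by (simp add: filterlim_at_top)
    ultimately have "eventually (\<lambda>n. False) sequentially"
    proof eventually_elim
      case (elim n)
      define T where "T = t n - x1"
      have "L / 2 \<le> F (T - real k * h)" if "k < M" for k
      proof -
        have "\<bar>F (t n - \<sigma> k) - F (T - real k * h)\<bar> \<le> 2 * C * \<bar>t n - \<sigma> k - (T - real k * h)\<bar>"
          by (rule Flip)
        also have "\<dots> \<le> 2 * C * \<delta>"
          using \<sigma>(2)[of k] C by (intro mult_left_mono) (auto simp: T_def)
        finally show ?thesis using elim that dl(2) by force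
      qed
      then have "(\<Sum>k<M. L / 2) \<le> (\<Sum>k<M. F (T - real k * h))" by (intro sum_mono) auto
      also have "\<dots> = R T - R (T - H)"
        using sum_lessThan_telescope'[of "\<lambda>k. R (T - real k * h)" M]
        by (simp add: F_def H_def algebra_simps)
      also have "\<dots> \<le> C * b + \<mu> * ((T - (T - H)) / a + 1)"
      proof -
        have "renewal_solution j (\<lambda>t. R t - R (T - H))"
          unfolding renewal_solution_def
        proof
          fix t
          have "(\<Sum>i\<in>A. p i * (R (t - y i) - R (T - H))) = (\<Sum>i\<in>A. p i * R (t - y i)) - R (T - H)"
            by (simp add: right_diff_distrib sum_subtractf sum_distrib_right[symmetric] p_sum)
          then show "R t - R (T - H) = j t + (\<Sum>i\<in>A. p i * (R (t - y i) - R (T - H)))"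
            using renewal_solution_D[OF R, of t] by linarith
        qed
        then have "\<bar>R T - R (T - H)\<bar> \<le> C * b + \<mu> * ((T - (T - H)) / a + 1)"
        proof (rule renewal_growth_bound[OF _ ab])
          show "\<bar>j t\<bar> \<le> \<mu>" if "T - H \<le> t" for t
            using s0[of t] that elim by (simp add: T_def less_imp_le)
          show "\<bar>R t - R (T - H)\<bar> \<le> C * b" if "T - H - b \<le> t" "t \<le> T - H" for t
            using lip[of t "T - H"] that C
            by (intro order_trans[OF lip] mult_left_mono) auto
          show "T - H \<le> T" using h by (simp add: H_def)
        qed
        then show ?thesis by simp
      qed
      also have "\<dots> = C * b + \<mu> + real M * L / 4"
        using ab(1) h by (simp add: H_def \<mu>_def field_simps)
      finally have "(\<Sum>k<M. L / 2) \<le> C * b + \<mu> + real M * L / 4" .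
      moreover have "(\<Sum>k<M. L / 2) = real M * L / 2" by simp
      ultimately have "real M * L / 4 \<le> C * b + \<mu>" by linarith
      then show ?case using M L by (simp add: field_simps)
    qed
    then show False by simp
  qed
  then show ?thesis using eventually_mono[OF up[OF \<epsilon>]] by (auto simp: F_def)
qed


lemma renewal_increment_tendsto_0:
  assumes nl: "\<not> discrete (group_closure (y ` A))"
    and R: "renewal_solution j R" and j: "(j \<longlongrightarrow> 0) at_top"
    and lip: "\<And>s t. \<bar>R s - R t\<bar> \<le> C * \<bar>s - t\<bar>"
    and h: "0 < h"
  shows "((\<lambda>t. R t - R (t - h)) \<longlongrightarrow> 0) at_top"
proof (rule tendstoI)
  fix \<epsilon> :: real assume "0 < \<epsilon>"
  then have e: "0 < \<epsilon> / 2" by simp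
  have "eventually (\<lambda>t. R t - R (t - h) \<le> \<epsilon> / 2) at_top"
    by (rule renewal_increment_limsup_nonpos[OF nl R j lip h e])
  moreover have "eventually (\<lambda>t. - R t - - R (t - h) \<le> \<epsilon> / 2) at_top"
    by (rule renewal_increment_limsup_nonpos[OF nl renewal_solution_uminus[OF R] _ _ h e])
       (use lip tendsto_minus[OF j] in \<open>auto simp: abs_minus_commute\<close>)
  ultimately show "eventually (\<lambda>t. dist (R t - R (t - h)) 0 < \<epsilon>) at_top"
    by eventually_elim (use \<open>0 < \<epsilon>\<close> in \<open>auto simp: abs_less_iff\<close>)
qed

text \<open>The Lipschitz condition serves to make \<open>I\<close> bounded on bounded intervals.\<close>

theorem elementary_renewal_theorem:
  assumes I: "renewal_solution J I" and J: "(J \<longlongrightarrow> c) at_top"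
    and lip: "\<And>s t. \<bar>I s - I t\<bar> \<le> C * \<bar>s - t\<bar>"
  shows "((\<lambda>t. I t / t) \<longlongrightarrow> c / mean) at_top"
proof -
  have lip': "C-lipschitz_on UNIV I"
    using lip lip[of 0 1] by (intro lipschitz_onI) (auto simp: dist_real_def)
  have "bounded ((\<lambda>t. I t - c / mean * t) ` {u..v})" for u v
    using continuous_on_subset[OF lipschitz_on_continuous_on[OF lip']]
    by (intro compact_imp_bounded compact_continuous_image continuous_intros) auto
  from renewal_sublinear[OF renewal_solution_minus_linear[OF I, of c] _ this]
  have "((\<lambda>t. (I t - c / mean * t) / t) \<longlongrightarrow> 0) at_top"
    using tendsto_diff[OF J tendsto_const[of c]] by simp
  then have "((\<lambda>t. (I t - c / mean * t) / t + c / mean) \<longlongrightarrow> c / mean) at_top"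
    using tendsto_add[OF _ tendsto_const[of "c / mean"]] by fastforce
  then show ?thesis
  proof (rule Lim_transform_eventually)
    show "eventually (\<lambda>t. (I t - c / mean * t) / t + c / mean = I t / t) at_top"
      using eventually_gt_at_top[of "0::real"] by eventually_elim (simp add: diff_divide_distrib)
  qed
qed

theorem blackwell_renewal_theorem:
  assumes nl: "\<not> discrete (group_closure (y ` A))"
    and I: "renewal_solution J I" and J: "(J \<longlongrightarrow> c) at_top"
    and lip: "\<And>s t. \<bar>I s - I t\<bar> \<le> C * \<bar>s - t\<bar>"
    and h: "0 < h"
  shows "((\<lambda>t. I t - I (t - h)) \<longlongrightarrow> h * c / mean) at_top"
proof -
  have "\<bar>(I s - c / mean * s) - (I t - c / mean * t)\<bar> \<le> (C + \<bar>c / mean\<bar>) * \<bar>s - t\<bar>" for s t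
  proof -
    have "(I s - c / mean * s) - (I t - c / mean * t) = (I s - I t) - c / mean * (s - t)"
      unfolding right_diff_distrib by simp
    also have "\<bar>\<dots>\<bar> \<le> \<bar>I s - I t\<bar> + \<bar>c / mean * (s - t)\<bar>" by (rule abs_triangle_ineq4)
    also have "\<dots> \<le> (C + \<bar>c / mean\<bar>) * \<bar>s - t\<bar>" using lip[of s t] unfolding abs_mult distrib_right by simp
    finally show ?thesis .
  qed
  from renewal_increment_tendsto_0[OF nl renewal_solution_minus_linear[OF I, of c] _ this h]
  have "((\<lambda>t. (I t - c / mean * t) - (I (t - h) - c / mean * (t - h))) \<longlongrightarrow> 0) at_top"
    using tendsto_diff[OF J tendsto_const[of c]] by simp
  from tendsto_add[OF this tendsto_const[of "h * c / mean"]]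
  have "((\<lambda>t. (I t - c / mean * t) - (I (t - h) - c / mean * (t - h)) + h * c / mean)
      \<longlongrightarrow> h * c / mean) at_top" by simp
  moreover have "(a - q * t) - (b - q * (t - h)) + h * q = a - b" for a b q t :: real
    by (simp add: algebra_simps)
  from this[where q = "c / mean"]
  have "(I t - c / mean * t) - (I (t - h) - c / mean * (t - h)) + h * c / mean = I t - I (t - h)" for t
    by simp
  ultimately show ?thesis by (simp only:)
qed

end

section \<open>Power integrals and logarithmic tail integrals\<close>

lemma set_integral_inverse_Ioc:
  fixes a b :: real
  assumes "0 < a" "a \<le> b"
  shows "set_integrable lborel {a<..b} (\<lambda>x. M / x)"
    and "(LBINT x:{a<..b}. M / x) = M * (ln b - ln a)"
proof -
  have "set_integrable lborel {a..b} (\<lambda>x. M / x)"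
    using assms by (intro borel_integrable_atLeastAtMost') (auto intro!: continuous_intros)
  then show "set_integrable lborel {a<..b} (\<lambda>x. M / x)"
    by (rule set_integrable_subset) auto
  have "(LBINT x:{a<..b}. M / x) = (LBINT x=a..b. M / x)"
    using assms by (simp add: interval_integral_Ioc)
  also have "\<dots> = M * ln b - M * ln a"
    using assms
    by (intro interval_integral_FTC_finite)
       (auto intro!: continuous_intros derivative_eq_intros
             simp: has_real_derivative_iff_has_vector_derivative[symmetric])
  finally show "(LBINT x:{a<..b}. M / x) = M * (ln b - ln a)" by (simp add: right_diff_distrib)
qed

lemma set_integral_powr_Ioc:
  fixes a b s :: real
  assumes "0 < a" "a \<le> b" "s \<noteq> 0"
  shows "set_integrable lborel {a<..b} (\<lambda>x. M * x powr (s - 1))"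
    and "(LBINT x:{a<..b}. M * x powr (s - 1)) = M * (b powr s - a powr s) / s"
proof -
  have "set_integrable lborel {a..b} (\<lambda>x. M * x powr (s - 1))"
    using assms by (intro borel_integrable_atLeastAtMost') (auto intro!: continuous_intros)
  then show "set_integrable lborel {a<..b} (\<lambda>x. M * x powr (s - 1))"
    by (rule set_integrable_subset) auto
  have "(LBINT x:{a<..b}. M * x powr (s - 1)) = (LBINT x=a..b. M * x powr (s - 1))"
    using assms by (simp add: interval_integral_Ioc)
  also have "\<dots> = M * b powr s / s - M * a powr s / s"
    using assms
    by (intro interval_integral_FTC_finite)
       (auto intro!: continuous_intros derivative_eq_intros
             simp: has_real_derivative_iff_has_vector_derivative[symmetric])
  finally show "(LBINT x:{a<..b}. M * x powr (s - 1)) = M * (b powr s - a powr s) / s"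
    by (simp add: right_diff_distrib diff_divide_distrib)
qed

lemma set_integral_powr_Ioi:
  fixes a c :: real
  assumes "0 < a" "0 < c"
  shows "set_integrable lborel {a<..} (\<lambda>x. M * x powr (- c - 1))"
    and "(LBINT x:{a<..}. M * x powr (- c - 1)) = M * a powr - c / c"
proof -
  have hi: "((\<lambda>x. x powr (- c - 1)) has_integral a powr - c / c) {a..}"
    using has_integral_powr_to_inf[of "- c - 1" a] assms by simp
  then have "(\<lambda>x. x powr (- c - 1)) absolutely_integrable_on {a..}"
    by (intro nonnegative_absolutely_integrable_1) auto
  then have int: "set_integrable lborel {a..} (\<lambda>x. x powr (- c - 1))"
    unfolding set_integrable_def by (subst (asm) integrable_completion) auto
  then have int': "set_integrable lborel {a<..} (\<lambda>x. x powr (- c - 1))"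
    by (rule set_integrable_subset) auto
  then show "set_integrable lborel {a<..} (\<lambda>x. M * x powr (- c - 1))" by simp
  have "(LBINT x:{a<..}. x powr (- c - 1)) = (LBINT x:{a..}. x powr (- c - 1))"
    using AE_lborel_singleton[of a]
    by (intro set_integral_cong_set) (auto simp: set_borel_measurable_def elim!: eventually_mono)
  also have "\<dots> = a powr - c / c"
    using set_borel_integral_eq_integral(2)[OF int] integral_unique[OF hi] by simp
  finally show "(LBINT x:{a<..}. M * x powr (- c - 1)) = M * a powr - c / c" by simp
qed

text \<open>The integral of the rescaled volume against the scale invariant measure \<open>d\<epsilon> / \<epsilon>\<close>; as a function of
\<open>- ln x\<close> it is the primitive to which renewal theory is applied.\<close>

definition tail_integral :: "real \<Rightarrow> (real \<Rightarrow> real) \<Rightarrow> real \<Rightarrow> real" where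
  "tail_integral c W x = (LBINT \<epsilon>:{x<..}. \<epsilon> powr - c * W \<epsilon> / \<epsilon>)"

context
  fixes c B :: real and W :: "real \<Rightarrow> real"
  assumes c: "0 < c" and W: "mono W" "\<And>x. 0 \<le> W x" "\<And>x. W x \<le> B"
begin

text \<open>Integrability is only at stake near infinity, where \<open>W\<close> is bounded and \<open>c > 0\<close>.\<close>

lemma tail_integrable:
  assumes x: "0 < x"
  shows "set_integrable lborel {x<..} (\<lambda>\<epsilon>. \<epsilon> powr - c * W \<epsilon> / \<epsilon>)"
proof (rule set_integrable_bound[OF set_integral_powr_Ioi(1)[OF x c, of B]])
  have [measurable]: "W \<in> borel_measurable borel" by (rule borel_measurable_mono[OF W(1)])
  show "set_borel_measurable lborel {x<..} (\<lambda>\<epsilon>. \<epsilon> powr - c * W \<epsilon> / \<epsilon>)"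
    unfolding set_borel_measurable_def by measurable
  have "norm (\<epsilon> powr - c * W \<epsilon> / \<epsilon>) \<le> norm (B * \<epsilon> powr (- c - 1))" if "x < \<epsilon>" for \<epsilon>
  proof -
    have "\<bar>W \<epsilon>\<bar> \<le> \<bar>B\<bar>" using W(2,3)[of \<epsilon>] by simp
    then show ?thesis using x that
      by (simp add: abs_mult powr_diff) (simp add: divide_right_mono mult_left_mono mult.commute)
  qed
  then show "AE \<epsilon> in lborel. \<epsilon> \<in> {x<..} \<longrightarrow> norm (\<epsilon> powr - c * W \<epsilon> / \<epsilon>) \<le> norm (B * \<epsilon> powr (- c - 1))"
    by simp
qed

lemma tail_integrable_Ioc:
  assumes "0 < x"
  shows "set_integrable lborel {x<..x'} (\<lambda>\<epsilon>. \<epsilon> powr - c * W \<epsilon> / \<epsilon>)"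
  by (rule set_integrable_subset[OF tail_integrable[OF assms]]) auto

lemma tail_integral_diff:
  assumes x: "0 < x" "x \<le> x'"
  shows "tail_integral c W x - tail_integral c W x' = (LBINT \<epsilon>:{x<..x'}. \<epsilon> powr - c * W \<epsilon> / \<epsilon>)"
proof -
  have e: "{x<..x'} \<union> {x'<..} = {x<..}" using x by auto
  have "0 < x'" using x by simp
  then have "(LBINT \<epsilon>:{x<..x'} \<union> {x'<..}. \<epsilon> powr - c * W \<epsilon> / \<epsilon>)
      = (LBINT \<epsilon>:{x<..x'}. \<epsilon> powr - c * W \<epsilon> / \<epsilon>) + (LBINT \<epsilon>:{x'<..}. \<epsilon> powr - c * W \<epsilon> / \<epsilon>)"
    by (intro set_integral_Un[OF _ tail_integrable_Ioc[OF x(1)] tail_integrable]) auto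
  then show ?thesis unfolding e tail_integral_def by simp
qed

lemma tail_integral_diff_le:
  assumes x: "0 < x" "x \<le> x'" and le: "\<And>\<epsilon>. x \<le> \<epsilon> \<Longrightarrow> \<epsilon> \<le> x' \<Longrightarrow> \<epsilon> powr - c * W \<epsilon> \<le> M"
  shows "tail_integral c W x - tail_integral c W x' \<le> M * (ln x' - ln x)"
proof -
  have "(LBINT \<epsilon>:{x<..x'}. \<epsilon> powr - c * W \<epsilon> / \<epsilon>) \<le> (LBINT \<epsilon>:{x<..x'}. M / \<epsilon>)"
  proof (rule set_integral_mono[OF tail_integrable_Ioc[OF x(1)] set_integral_inverse_Ioc(1)[OF x]])
    fix \<epsilon> assume "\<epsilon> \<in> {x<..x'}"
    then show "\<epsilon> powr - c * W \<epsilon> / \<epsilon> \<le> M / \<epsilon>" using x le[of \<epsilon>] by (intro divide_right_mono) auto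
  qed
  then show ?thesis by (simp only: tail_integral_diff[OF x] set_integral_inverse_Ioc(2)[OF x])
qed

lemma tail_integral_diff_ge:
  assumes x: "0 < x" "x \<le> x'" and le: "\<And>\<epsilon>. x \<le> \<epsilon> \<Longrightarrow> \<epsilon> \<le> x' \<Longrightarrow> M \<le> \<epsilon> powr - c * W \<epsilon>"
  shows "M * (ln x' - ln x) \<le> tail_integral c W x - tail_integral c W x'"
proof -
  have "(LBINT \<epsilon>:{x<..x'}. M / \<epsilon>) \<le> (LBINT \<epsilon>:{x<..x'}. \<epsilon> powr - c * W \<epsilon> / \<epsilon>)"
  proof (rule set_integral_mono[OF set_integral_inverse_Ioc(1)[OF x] tail_integrable_Ioc[OF x(1)]])
    fix \<epsilon> assume "\<epsilon> \<in> {x<..x'}"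
    then show "M / \<epsilon> \<le> \<epsilon> powr - c * W \<epsilon> / \<epsilon>" using x le[of \<epsilon>] by (intro divide_right_mono) auto
  qed
  then show ?thesis by (simp only: tail_integral_diff[OF x] set_integral_inverse_Ioc(2)[OF x])
qed

lemma tail_integral_antimono:
  assumes x: "0 < x" "x \<le> x'"
  shows "tail_integral c W x' \<le> tail_integral c W x"
  using tail_integral_diff_ge[OF x, of 0] W(2) by simp

text \<open>Substitution \<open>\<epsilon> = \<rho> * u\<close>: the measure \<open>d\<epsilon> / \<epsilon>\<close> is invariant, so only the factor \<open>\<epsilon> powr (- c)\<close>
contributes.\<close>

lemma tail_integral_scale:
  assumes x: "0 < x" and \<rho>: "0 < \<rho>"
  shows "set_integrable lborel {x<..} (\<lambda>\<epsilon>. \<epsilon> powr - c * W (\<epsilon> / \<rho>) / \<epsilon>)"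
    and "tail_integral c (\<lambda>\<epsilon>. W (\<epsilon> / \<rho>)) x = \<rho> powr - c * tail_integral c W (x / \<rho>)"
proof -
  define F where "F = (\<lambda>\<epsilon>. indicat_real {x<..} \<epsilon> *\<^sub>R (\<epsilon> powr - c * W (\<epsilon> / \<rho>) / \<epsilon>))"
  have F: "F (0 + \<rho> * u) = \<rho> powr - c / \<rho> * (indicat_real {x / \<rho><..} u *\<^sub>R (u powr - c * W u / u))" for u
  proof (cases "x / \<rho> < u")
    case True
    moreover have "0 < u" using True x \<rho> less_trans[of 0 "x / \<rho>" u] by simp
    moreover have "x < \<rho> * u" using True \<rho> by (simp add: pos_divide_less_eq mult.commute)
    ultimately show ?thesis using \<rho> by (simp add: F_def powr_mult)
  next
    case False
    moreover have "\<not> x < \<rho> * u" using False \<rho> by (simp add: pos_divide_less_eq mult.commute)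
    ultimately show ?thesis by (simp add: F_def)
  qed
  have "integrable lborel (\<lambda>u. F (0 + \<rho> * u))"
    unfolding F using tail_integrable[of "x / \<rho>"] x \<rho>
    by (intro integrable_mult_right) (simp add: set_integrable_def)
  then show "set_integrable lborel {x<..} (\<lambda>\<epsilon>. \<epsilon> powr - c * W (\<epsilon> / \<rho>) / \<epsilon>)"
    using lborel_integrable_real_affine_iff[of \<rho> F 0] \<rho> by (simp add: set_integrable_def F_def)
  have "tail_integral c (\<lambda>\<epsilon>. W (\<epsilon> / \<rho>)) x = \<bar>\<rho>\<bar> *\<^sub>R (\<integral>u. F (0 + \<rho> * u) \<partial>lborel)"
    using lborel_integral_real_affine[of \<rho> F 0] \<rho>
    by (simp add: tail_integral_def set_lebesgue_integral_def F_def)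
  also have "\<dots> = \<rho> powr - c * tail_integral c W (x / \<rho>)"
    unfolding F integral_mult_right_zero
    using \<rho> by (simp add: tail_integral_def set_lebesgue_integral_def)
  finally show "tail_integral c (\<lambda>\<epsilon>. W (\<epsilon> / \<rho>)) x = \<rho> powr - c * tail_integral c W (x / \<rho>)" .
qed

end

lemma set_integral_sum:
  fixes f :: "'i \<Rightarrow> 'b \<Rightarrow> real"
  assumes "\<And>i. i \<in> A \<Longrightarrow> set_integrable M X (f i)"
  shows "set_integrable M X (\<lambda>x. \<Sum>i\<in>A. f i x)"
    and "(LINT x:X|M. \<Sum>i\<in>A. f i x) = (\<Sum>i\<in>A. LINT x:X|M. f i x)"
  using assms unfolding set_integrable_def set_lebesgue_integral_def
  by (simp_all add: sum_distrib_left)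

lemma filterlim_minus_ln_at_right_0: "filterlim (\<lambda>x::real. - ln x) at_top (at_right 0)"
  using ln_at_0 by (simp add: filterlim_uminus_at_top)

section \<open>From scaling equations to asymptotics at zero\<close>

text \<open>An analytic abstraction of the tiling: \<open>V\<close> and \<open>v\<close> are the volume functions of the tiling and its
generator, and \<open>D + c\<close> is the dimension of the ambient space.\<close>

locale scaling_renewal =
  fixes A :: "'i set" and \<rho> :: "'i \<Rightarrow> real" and D c B C :: real and V v :: "real \<Rightarrow> real"
  assumes fin: "finite A" and ratio: "\<And>i. i \<in> A \<Longrightarrow> 0 < \<rho> i" "\<And>i. i \<in> A \<Longrightarrow> \<rho> i < 1"
    and moran: "(\<Sum>i\<in>A. \<rho> i powr D) = 1" and c: "0 < c"
    and V: "mono V" "\<And>x. 0 \<le> V x" "\<And>x. V x \<le> B"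
    and v: "mono v" "\<And>x. 0 \<le> v x" "\<And>x. v x \<le> B"
    and scaling: "\<And>x. 0 < x \<Longrightarrow> V x = v x + (\<Sum>i\<in>A. \<rho> i powr (D + c) * V (x / \<rho> i))"
    and limit: "(tail_integral c v \<longlongrightarrow> C) (at_right 0)"
begin

sublocale step_distribution A "\<lambda>i. \<rho> i powr D" "\<lambda>i. - ln (\<rho> i)"
  using fin ratio moran by unfold_locales (force simp: ln_less_zero_iff)+

definition I :: "real \<Rightarrow> real" where "I t = tail_integral c V (exp (- t))"
definition J :: "real \<Rightarrow> real" where "J t = tail_integral c v (exp (- t))"

text \<open>The weight \<open>\<rho> i powr (D + c)\<close> of the scaling equation and the factor \<open>\<rho> i powr (- c)\<close> from
\<open>tail_integral_scale\<close> combine to the probability \<open>\<rho> i powr D\<close>.\<close>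

lemma renewal_I: "renewal_solution J I"
  unfolding renewal_solution_def
proof
  fix t :: real
  let ?x = "exp (- t)"
  have sc: "\<epsilon> powr - c * V \<epsilon> / \<epsilon> =
      \<epsilon> powr - c * v \<epsilon> / \<epsilon> + (\<Sum>i\<in>A. \<rho> i powr (D + c) * (\<epsilon> powr - c * V (\<epsilon> / \<rho> i) / \<epsilon>))" if "?x < \<epsilon>" for \<epsilon>
  proof -
    have "0 < \<epsilon>" using that by (rule less_trans[rotated]) simp
    then show ?thesis
      by (subst scaling) (simp_all add: distrib_left add_divide_distrib sum_distrib_left sum_divide_distrib mult_ac)
  qed
  have int: "set_integrable lborel {?x<..} (\<lambda>\<epsilon>. \<rho> i powr (D + c) * (\<epsilon> powr - c * V (\<epsilon> / \<rho> i) / \<epsilon>))"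
    if "i \<in> A" for i
    by (intro set_integrable_mult_right tail_integral_scale(1)[OF c V] ratio(1)[OF that]) simp
  have "I t = (LBINT \<epsilon>:{?x<..}. \<epsilon> powr - c * v \<epsilon> / \<epsilon> +
      (\<Sum>i\<in>A. \<rho> i powr (D + c) * (\<epsilon> powr - c * V (\<epsilon> / \<rho> i) / \<epsilon>)))"
    unfolding I_def tail_integral_def
    by (rule set_lebesgue_integral_cong) (use sc in auto)
  also have "\<dots> = J t + (LBINT \<epsilon>:{?x<..}. \<Sum>i\<in>A. \<rho> i powr (D + c) * (\<epsilon> powr - c * V (\<epsilon> / \<rho> i) / \<epsilon>))"
    unfolding J_def tail_integral_def
    by (intro set_integral_add(2) tail_integrable[OF c v] set_integral_sum(1) int) auto
  also have "(LBINT \<epsilon>:{?x<..}. \<Sum>i\<in>A. \<rho> i powr (D + c) * (\<epsilon> powr - c * V (\<epsilon> / \<rho> i) / \<epsilon>))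
      = (\<Sum>i\<in>A. \<rho> i powr (D + c) * tail_integral c (\<lambda>\<epsilon>. V (\<epsilon> / \<rho> i)) ?x)"
    using int by (subst set_integral_sum(2)) (auto simp: tail_integral_def simp flip: times_divide_eq_right)
  also have "\<dots> = (\<Sum>i\<in>A. \<rho> i powr D * I (t - - ln (\<rho> i)))"
  proof (rule sum.cong[OF refl])
    fix i assume i: "i \<in> A"
    have "exp (- (t - - ln (\<rho> i))) = ?x / \<rho> i"
      using ratio(1)[OF i] by (simp add: exp_diff)
    moreover have "\<rho> i powr (D + c) * \<rho> i powr - c = \<rho> i powr D"
      by (simp add: powr_add[symmetric])
    ultimately show "\<rho> i powr (D + c) * tail_integral c (\<lambda>\<epsilon>. V (\<epsilon> / \<rho> i)) ?x
        = \<rho> i powr D * I (t - - ln (\<rho> i))"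
      using tail_integral_scale(2)[OF c V, of ?x "\<rho> i"] ratio(1)[OF i]
      by (simp add: I_def mult.assoc[symmetric])
  qed
  finally show "I t = J t + (\<Sum>i\<in>A. \<rho> i powr D * I (t - - ln (\<rho> i)))" .
qed

lemma J_tendsto: "(J \<longlongrightarrow> C) at_top"
proof -
  have "filterlim (\<lambda>t::real. exp (- t)) (at_right 0) at_top"
    unfolding filterlim_at
    using filterlim_compose[OF exp_at_bot filterlim_uminus_at_bot_at_top] by simp
  from filterlim_compose[OF limit this] show ?thesis by (simp add: J_def[abs_def])
qed

lemma I_mono: "s \<le> t \<Longrightarrow> I s \<le> I t"
  unfolding I_def by (intro tail_integral_antimono[OF c V]) auto

lemma J_le: "J t \<le> C"
proof (rule tendsto_lowerbound[OF J_tendsto])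
  show "eventually (\<lambda>s. J t \<le> J s) at_top"
    using eventually_ge_at_top[of t]
    by eventually_elim (auto simp: J_def intro!: tail_integral_antimono[OF c v])
qed simp

text \<open>On the interval from \<open>exp (- t)\<close> to \<open>exp (- (t - h))\<close> the function \<open>V\<close> is smallest at the left end and the factor
\<open>\<epsilon> powr (- c)\<close> loses at most \<open>exp (- (c * h))\<close>. This and its counterpart \<open>I_increment_le\<close> are the
Tauberian estimates that lead from increments of \<open>I\<close> back to \<open>V\<close>.\<close>

lemma I_increment_ge:
  assumes h: "0 \<le> h"
  shows "exp (- (c * h)) * (exp (- t) powr - c * V (exp (- t))) * h \<le> I t - I (t - h)"
proof -
  have "exp (- (c * h)) * (exp (- t) powr - c * V (exp (- t))) \<le> \<epsilon> powr - c * V \<epsilon>"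
    if e: "exp (- t) \<le> \<epsilon>" "\<epsilon> \<le> exp (- (t - h))" for \<epsilon>
  proof -
    have "exp (- (c * h)) * exp (- t) powr - c = exp (- (t - h)) powr - c"
      by (simp add: powr_def exp_add[symmetric] algebra_simps)
    also have "\<dots> \<le> \<epsilon> powr - c"
      using e c less_le_trans[OF exp_gt_zero e(1)] by (intro powr_mono2') auto
    finally show ?thesis
      using monoD[OF V(1) e(1)] V(2) by (simp add: mult.assoc[symmetric] mult_mono)
  qed
  from tail_integral_diff_ge[OF c V _ _ this, where x = "exp (- t)" and x' = "exp (- (t - h))"]
  show ?thesis using h by (simp add: I_def)
qed

lemma I_increment_le:
  assumes h: "0 \<le> h"
  shows "I (t + h) - I t \<le> exp (c * h) * (exp (- t) powr - c * V (exp (- t))) * h"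
proof -
  have "\<epsilon> powr - c * V \<epsilon> \<le> exp (c * h) * (exp (- t) powr - c * V (exp (- t)))"
    if e: "exp (- (t + h)) \<le> \<epsilon>" "\<epsilon> \<le> exp (- t)" for \<epsilon>
  proof -
    have "\<epsilon> powr - c \<le> exp (- (t + h)) powr - c"
      using e c by (intro powr_mono2') auto
    also have "\<dots> = exp (c * h) * exp (- t) powr - c"
      by (simp add: powr_def exp_add[symmetric] algebra_simps)
    finally show ?thesis
      using monoD[OF V(1) e(2)] V(2) by (simp add: mult.assoc[symmetric] mult_mono)
  qed
  from tail_integral_diff_le[OF c V _ _ this, where x = "exp (- (t + h))" and x' = "exp (- t)"]
  show ?thesis using h by (simp add: I_def)
qed

text \<open>Rearranged, the renewal equation says that the weighted increments of \<open>I\<close> over the steps add up to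
\<open>J t \<le> C\<close>. Hence the increment of \<open>I\<close> over the shortest step is bounded, and with it the rescaled
volume.\<close>

lemma scaled_V_bounded: obtains M where "\<And>x. 0 < x \<Longrightarrow> x powr - c * V x \<le> M"
proof -
  obtain a b where a: "0 < a" "\<And>i. i \<in> A \<Longrightarrow> a \<le> - ln (\<rho> i)" "\<And>i. i \<in> A \<Longrightarrow> - ln (\<rho> i) \<le> b"
    using step_bounds by blast
  show thesis
  proof (rule that)
    fix x :: real assume x: "0 < x"
    define t where "t = - ln x"
    have "exp (- (c * a)) * (exp (- t) powr - c * V (exp (- t))) * a \<le> I t - I (t - a)"
      using a(1) by (intro I_increment_ge) auto
    also have "\<dots> = (\<Sum>i\<in>A. \<rho> i powr D * (I t - I (t - a)))"
      by (simp add: sum_distrib_right[symmetric] moran)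
    also have "\<dots> \<le> (\<Sum>i\<in>A. \<rho> i powr D * (I t - I (t - - ln (\<rho> i))))"
      using a(2) by (intro sum_mono mult_left_mono diff_left_mono I_mono) (force+)
    also have "\<dots> = J t"
      using renewal_solution_D[OF renewal_I, of t]
      by (simp add: right_diff_distrib sum_subtractf sum_distrib_right[symmetric] moran)
    also have "\<dots> \<le> C" by (rule J_le)
    finally show "x powr - c * V x \<le> C * exp (c * a) / a"
      using a(1) x by (simp add: t_def exp_minus field_simps)
  qed
qed

lemma I_lipschitz: obtains M where "\<And>s t. \<bar>I s - I t\<bar> \<le> M * \<bar>s - t\<bar>"
proof -
  obtain M where M: "\<And>x. 0 < x \<Longrightarrow> x powr - c * V x \<le> M" using scaled_V_bounded by blast
  have *: "\<bar>I s - I t\<bar> \<le> M * \<bar>s - t\<bar>" if "s \<le> t" for s t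
  proof -
    have "tail_integral c V (exp (- t)) - tail_integral c V (exp (- s)) \<le> M * (ln (exp (- s)) - ln (exp (- t)))"
      using that M by (intro tail_integral_diff_le[OF c V]) (auto intro: less_le_trans[OF exp_gt_zero])
    then show ?thesis using I_mono[OF that] that by (simp add: I_def)
  qed
  show thesis
  proof (rule that)
    show "\<bar>I s - I t\<bar> \<le> M * \<bar>s - t\<bar>" for s t
      using *[of s t] *[of t s] by (cases "s \<le> t") (simp_all add: abs_minus_commute)
  qed
qed

text \<open>The logarithmic average over \<open>{\<delta>..1}\<close> is \<open>(I t - I 0) / t\<close> at \<open>t = - ln \<delta>\<close>.\<close>

theorem average_limit:
  "((\<lambda>\<delta>. 1 / \<bar>ln \<delta>\<bar> * (LBINT \<epsilon>:{\<delta>..1}. \<epsilon> powr - c * V \<epsilon> / \<epsilon>)) \<longlongrightarrow> C / mean) (at_right 0)"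
proof -
  obtain M where "\<And>s t. \<bar>I s - I t\<bar> \<le> M * \<bar>s - t\<bar>" using I_lipschitz by blast
  then have "((\<lambda>t. I t / t) \<longlongrightarrow> C / mean) at_top"
    by (rule elementary_renewal_theorem[OF renewal_I J_tendsto])
  moreover have "((\<lambda>t. I 0 / t) \<longlongrightarrow> 0) at_top"
    by (intro tendsto_divide_0[OF tendsto_const] filterlim_at_top_imp_at_infinity filterlim_ident)
  ultimately have "((\<lambda>t. I t / t - I 0 / t) \<longlongrightarrow> C / mean) at_top"
    using tendsto_diff by fastforce
  from filterlim_compose[OF this filterlim_minus_ln_at_right_0]
  have "((\<lambda>\<delta>. I (- ln \<delta>) / - ln \<delta> - I 0 / - ln \<delta>) \<longlongrightarrow> C / mean) (at_right 0)" .
  then show ?thesis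
  proof (rule Lim_transform_eventually)
    have "eventually (\<lambda>\<delta>::real. \<delta> \<in> {0<..<1}) (at_right 0)"
      by (rule eventually_at_right_real) simp
    then show "eventually (\<lambda>\<delta>. I (- ln \<delta>) / - ln \<delta> - I 0 / - ln \<delta>
        = 1 / \<bar>ln \<delta>\<bar> * (LBINT \<epsilon>:{\<delta>..1}. \<epsilon> powr - c * V \<epsilon> / \<epsilon>)) (at_right 0)"
    proof eventually_elim
      case (elim \<delta>)
      have [measurable]: "V \<in> borel_measurable borel" by (rule borel_measurable_mono[OF V(1)])
      have "(LBINT \<epsilon>:{\<delta>..1}. \<epsilon> powr - c * V \<epsilon> / \<epsilon>) = (LBINT \<epsilon>:{\<delta><..1}. \<epsilon> powr - c * V \<epsilon> / \<epsilon>)"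
        using AE_lborel_singleton[of \<delta>]
        by (intro set_integral_cong_set) (auto simp: set_borel_measurable_def elim!: eventually_mono)
      also have "\<dots> = I (- ln \<delta>) - I 0"
        using elim tail_integral_diff[OF c V, of \<delta> 1] by (simp add: I_def)
      finally show ?case using elim by (simp add: diff_divide_distrib ln_less_zero_iff)
    qed
  qed
qed

text \<open>Blackwell's theorem determines the limit of the difference quotients of \<open>I\<close> over any fixed \<open>h\<close>; these
enclose the rescaled volume up to factors \<open>exp (c * h)\<close> and \<open>exp (- c * h)\<close>, and \<open>h\<close> is arbitrary.\<close>

theorem nonlattice_limit:
  assumes nl: "\<not> discrete (group_closure ((\<lambda>i. - ln (\<rho> i)) ` A))"
  shows "((\<lambda>\<epsilon>. \<epsilon> powr - c * V \<epsilon>) \<longlongrightarrow> C / mean) (at_right 0)"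
proof -
  define f where "f = (\<lambda>t. exp (- t) powr - c * V (exp (- t)))"
  obtain M where lip: "\<And>s t. \<bar>I s - I t\<bar> \<le> M * \<bar>s - t\<bar>" using I_lipschitz by blast
  note blackwell = blackwell_renewal_theorem[OF nl renewal_I J_tendsto lip]
  have exp_lim: "((\<lambda>h. exp (b * h) * (C / mean)) \<longlongrightarrow> C / mean) (at_right 0)" for b
  proof -
    have "((\<lambda>h. exp (b * h) * (C / mean)) \<longlongrightarrow> exp (b * 0) * (C / mean)) (at_right 0)"
      by (intro tendsto_intros)
    then show ?thesis by simp
  qed
  have pos: "eventually (\<lambda>h::real. 0 < h) (at_right 0)" by (rule eventually_at_right_less)
  have "(f \<longlongrightarrow> C / mean) at_top"
  proof (rule order_tendstoI)
    fix u assume u: "C / mean < u"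
    obtain h where h: "0 < h" "exp (c * h) * (C / mean) < u"
      using eventually_happens[OF eventually_conj[OF pos order_tendstoD(2)[OF exp_lim[of c] u]]] by auto
    have "((\<lambda>t. exp (c * h) * (I t - I (t - h)) / h) \<longlongrightarrow> exp (c * h) * (h * C / mean) / h) at_top"
      using h(1) by (intro tendsto_intros blackwell) auto
    also have "exp (c * h) * (h * C / mean) / h = exp (c * h) * (C / mean)" using h(1) by simp
    finally have "eventually (\<lambda>t. exp (c * h) * (I t - I (t - h)) / h < u) at_top"
      using h(2) by (rule order_tendstoD)
    then show "eventually (\<lambda>t. f t < u) at_top"
    proof eventually_elim
      case (elim t)
      have "f t \<le> exp (c * h) * (I t - I (t - h)) / h"
        using I_increment_ge[of h t] h(1) by (simp add: f_def exp_minus field_simps)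
      then show ?case using elim by simp
    qed
  next
    fix u assume u: "u < C / mean"
    obtain h where h: "0 < h" "u < exp (- c * h) * (C / mean)"
      using eventually_happens[OF eventually_conj[OF pos order_tendstoD(1)[OF exp_lim[of "- c"] u]]] by auto
    have "((\<lambda>t. I (t + h) - I (t + h - h)) \<longlongrightarrow> h * C / mean) at_top"
      by (rule filterlim_compose[OF blackwell[OF h(1)]])
         (rule filterlim_at_top_mono[OF filterlim_ident], use h in auto)
    then have "((\<lambda>t. exp (- c * h) * (I (t + h) - I t) / h) \<longlongrightarrow> exp (- c * h) * (h * C / mean) / h) at_top"
      using h(1) by (intro tendsto_intros) auto
    also have "exp (- c * h) * (h * C / mean) / h = exp (- c * h) * (C / mean)" using h(1) by simp
    finally have "eventually (\<lambda>t. u < exp (- c * h) * (I (t + h) - I t) / h) at_top"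
      using h(2) by (rule order_tendstoD)
    then show "eventually (\<lambda>t. u < f t) at_top"
    proof eventually_elim
      case (elim t)
      have "exp (- c * h) * (I (t + h) - I t) / h \<le> f t"
        using I_increment_le[of h t] h(1) by (simp add: f_def exp_minus field_simps)
      then show ?case using elim by simp
    qed
  qed
  from filterlim_compose[OF this filterlim_minus_ln_at_right_0]
  show ?thesis
  proof (rule Lim_transform_eventually)
    show "eventually (\<lambda>\<epsilon>. f (- ln \<epsilon>) = \<epsilon> powr - c * V \<epsilon>) (at_right 0)"
      using pos by eventually_elim (simp add: f_def)
  qed
qed

end

section \<open>Similarities and Lebesgue measure\<close>

lemma similarity_surj:
  fixes f :: "'a::euclidean_space \<Rightarrow> 'a"
  assumes "similarity_with_ratio f c" "0 < c"
  shows "surj f"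
proof -
  \<comment> \<open>An isometry fixing the origin is an injective linear map, hence surjective in finite dimension.\<close>
  define T where "T = (\<lambda>x. (f x - f 0) /\<^sub>R c)"
  have "dist (T x) (T y) = dist x y" for x y
  proof -
    have "T x - T y = (f x - f y) /\<^sub>R c" by (simp add: T_def algebra_simps)
    then show ?thesis
      using assms by (simp add: dist_norm similarity_with_ratio_def)
  qed
  then have "orthogonal_transformation T"
    by (auto simp: orthogonal_transformation_isometry T_def)
  then have T: "surj T" by (rule orthogonal_transformation_surj)
  show ?thesis
  proof (rule surjI)
    fix z
    have "T (inv T ((z - f 0) /\<^sub>R c)) = (z - f 0) /\<^sub>R c" by (rule surj_f_inv_f[OF T])
    then show "f (inv T ((z - f 0) /\<^sub>R c)) = z" using assms(2) by (simp add: T_def)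
  qed
qed

lemma similarity_inj:
  assumes "similarity_with_ratio f c" "0 < c"
  shows "inj f"
proof (rule injI)
  fix x z assume "f x = f z"
  then have "c * dist x z = 0" using assms by (metis dist_self similarity_with_ratio_def)
  then show "x = z" using assms by simp
qed

lemma similarity_image_cball:
  fixes f :: "'a::euclidean_space \<Rightarrow> 'a"
  assumes "similarity_with_ratio f c" "0 < c"
  shows "f ` cball x \<rho> = cball (f x) (c * \<rho>)"
proof
  show "cball (f x) (c * \<rho>) \<subseteq> f ` cball x \<rho>"
  proof
    fix w assume w: "w \<in> cball (f x) (c * \<rho>)"
    obtain z where "w = f z" using similarity_surj[OF assms] by (metis surj_def)
    with w assms show "w \<in> f ` cball x \<rho>" by (auto simp: similarity_with_ratio_def)
  qed
qed (use assms in \<open>auto simp: similarity_with_ratio_def\<close>)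

lemma similarity_open_image:
  fixes f :: "'a::euclidean_space \<Rightarrow> 'a"
  assumes "similarity_with_ratio f c" "0 < c" "open A"
  shows "open (f ` A)"
  unfolding open_contains_cball
proof
  fix w assume "w \<in> f ` A"
  then obtain x where x: "x \<in> A" "w = f x" by auto
  then obtain \<rho> where "0 < \<rho>" "cball x \<rho> \<subseteq> A" using assms(3) open_contains_cball by blast
  then have "cball w (c * \<rho>) \<subseteq> f ` A" "0 < c * \<rho>"
    using assms(2) similarity_image_cball[OF assms(1,2), of x \<rho>] x(2) by (metis image_mono, simp)
  then show "\<exists>e>0. cball w e \<subseteq> f ` A" by blast
qed

lemma similarity_continuous:
  assumes "similarity_with_ratio f c" "0 < c"
  shows "continuous_on X f"
proof -
  have "c-lipschitz_on X f"
    using assms by (intro lipschitz_onI) (auto simp: similarity_with_ratio_def)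
  then show ?thesis by (rule lipschitz_on_continuous_on)
qed

text \<open>A similarity maps balls to balls, so the scaling law is clear for balls. By Vitali's covering theorem
an open set is a disjoint union of countably many closed balls up to a null set, and similarities, being
Lipschitz, preserve null sets.\<close>

lemma emeasure_similarity_image:
  fixes f :: "'a::euclidean_space \<Rightarrow> 'a"
  assumes f: "similarity_with_ratio f c" "0 < c" and A: "open A"
  shows "emeasure lebesgue (f ` A) = ennreal (c ^ DIM('a)) * emeasure lebesgue A"
proof -
  define K :: "('a \<times> real) set" where "K = {(x, \<rho>). 0 < \<rho> \<and> cball x \<rho> \<subseteq> A}"
  have cover: "\<exists>i. i \<in> K \<and> x \<in> cball (fst i) (snd i) \<and> snd i < d" if xd: "x \<in> A" "0 < d" for x d
  proof -
    obtain \<rho> where "0 < \<rho>" "cball x \<rho> \<subseteq> A" using A xd open_contains_cball by blast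
    moreover have "cball x (min \<rho> (d / 2)) \<subseteq> cball x \<rho>" by auto
    ultimately have "(x, min \<rho> (d / 2)) \<in> K" using xd unfolding K_def by auto
    then show ?thesis using xd \<open>0 < \<rho>\<close> by (intro exI[of _ "(x, min \<rho> (d / 2))"]) auto
  qed
  have radius: "0 < snd i" if "i \<in> K" for i using that by (auto simp: K_def)
  obtain C where C: "countable C" "C \<subseteq> K"
    "pairwise (\<lambda>i j. disjnt (cball (fst i) (snd i)) (cball (fst j) (snd j))) C"
    "negligible (A - (\<Union>i\<in>C. cball (fst i) (snd i)))"
    by (rule Vitali_covering_theorem_cballs[of K snd A fst], erule radius, rule cover; (assumption | rule that))
  define B where "B = (\<lambda>i::'a \<times> real. cball (fst i) (snd i))"
  define Z where "Z = A - (\<Union>i\<in>C. B i)"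
  have Z: "negligible Z" using C(4) by (simp add: Z_def B_def)
  have BA: "B i \<subseteq> A" and pos: "0 < snd i" if "i \<in> C" for i
    using subsetD[OF C(2) that] by (simp_all add: K_def B_def case_prod_beta)
  have disj: "disjoint_family_on B C"
    using C(3) by (auto simp: disjoint_family_on_def pairwise_def disjnt_def B_def)
  have disj': "disjoint_family_on (\<lambda>i. f ` B i) C"
    using disj similarity_inj[OF f] by (fastforce simp: disjoint_family_on_def inj_def)
  have Z': "negligible (f ` Z)"
  proof (rule negligible_locally_Lipschitz_image[OF order_refl Z])
    fix x assume "x \<in> Z"
    show "\<exists>T L. open T \<and> x \<in> T \<and> (\<forall>z\<in>Z \<inter> T. norm (f z - f x) \<le> L * norm (z - x))"
      using f(1) by (intro exI[of _ UNIV] exI[of _ c]) (simp add: similarity_with_ratio_def flip: dist_norm)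
  qed
  have decompose: "emeasure lebesgue (X \<union> (\<Union>i\<in>C. Y i)) = (\<integral>\<^sup>+i. emeasure lebesgue (Y i) \<partial>count_space C)"
    if "negligible X" "\<And>i. closed (Y i)" "disjoint_family_on Y C" for X :: "'a set" and Y
  proof -
    have "emeasure lebesgue (X \<union> (\<Union>i\<in>C. Y i)) = emeasure lebesgue (\<Union>i\<in>C. Y i)"
      using that C(1) by (subst Un_commute, intro emeasure_Un_null_set)
        (auto simp: negligible_iff_null_sets intro!: sets.countable_UN')
    also have "\<dots> = (\<integral>\<^sup>+i. emeasure lebesgue (Y i) \<partial>count_space C)"
      using that C(1) by (intro emeasure_UN_countable) auto
    finally show ?thesis .
  qed
  have eA: "A = Z \<union> (\<Union>i\<in>C. B i)" using BA by (auto simp: Z_def)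
  have "f ` A = f ` Z \<union> (\<Union>i\<in>C. f ` B i)" by (subst eA) auto
  then have "emeasure lebesgue (f ` A) = (\<integral>\<^sup>+i. emeasure lebesgue (f ` B i) \<partial>count_space C)"
    using decompose[OF Z' _ disj'] similarity_image_cball[OF f] by (simp add: B_def)
  also have "\<dots> = (\<integral>\<^sup>+i. ennreal (c ^ DIM('a)) * emeasure lebesgue (B i) \<partial>count_space C)"
  proof (rule nn_integral_cong)
    fix i assume "i \<in> space (count_space C)"
    then have "0 < snd i" using pos by simp
    then show "emeasure lebesgue (f ` B i) = ennreal (c ^ DIM('a)) * emeasure lebesgue (B i)"
      using f(2) by (simp add: B_def similarity_image_cball[OF f] emeasure_cball power_mult_distrib
          ennreal_mult[symmetric] mult.left_commute)
  qed
  also have "\<dots> = ennreal (c ^ DIM('a)) * (\<integral>\<^sup>+i. emeasure lebesgue (B i) \<partial>count_space C)"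
    by (rule nn_integral_cmult) auto
  also have "(\<integral>\<^sup>+i. emeasure lebesgue (B i) \<partial>count_space C) = emeasure lebesgue A"
  proof -
    have "emeasure lebesgue (Z \<union> (\<Union>i\<in>C. B i)) = (\<integral>\<^sup>+i. emeasure lebesgue (B i) \<partial>count_space C)"
      by (rule decompose[OF Z _ disj]) (simp add: B_def)
    then show ?thesis by (simp only: eA[symmetric])
  qed
  finally show ?thesis .
qed

lemma measure_similarity_image:
  fixes f :: "'a::euclidean_space \<Rightarrow> 'a"
  assumes "similarity_with_ratio f c" "0 < c" "open A"
  shows "measure lebesgue (f ` A) = c ^ DIM('a) * measure lebesgue A"
  using emeasure_similarity_image[OF assms] assms(2)
  by (simp add: measure_def enn2real_mult)

section \<open>Inner parallel volumes\<close>

text \<open>For bounded open \<open>X\<close> this is the complement in \<open>X\<close> of the inner parallel set (\<open>erosion_eq\<close>). In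
contrast to the latter it is open and is described by balls, hence easy to map by similarities and to
split along disjoint unions.\<close>

definition erosion :: "real \<Rightarrow> 'a::metric_space set \<Rightarrow> 'a set" where
  "erosion \<epsilon> X = {x. cball x \<epsilon> \<subseteq> X}"

lemma erosion_subset: "0 \<le> \<epsilon> \<Longrightarrow> erosion \<epsilon> X \<subseteq> X"
  by (auto simp: erosion_def)

lemma erosion_antimono: "\<epsilon> \<le> \<epsilon>' \<Longrightarrow> erosion \<epsilon>' X \<subseteq> erosion \<epsilon> X"
  by (auto simp: erosion_def)

lemma bounded_frontier_nonempty:
  fixes X :: "'a::euclidean_space set"
  assumes "bounded X" "X \<noteq> {}"
  shows "frontier X \<noteq> {}"
proof -
  have "X \<noteq> UNIV" using assms(1) not_bounded_UNIV by blast
  then show ?thesis using assms(2) frontier_not_empty by blast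
qed

text \<open>A closed ball is connected, so if it meets \<open>X\<close> but is not contained in \<open>X\<close>, it meets the frontier.
Conversely the distance to the frontier is attained, at a point outside the open set \<open>X\<close>.\<close>

lemma erosion_eq:
  fixes X :: "'a::euclidean_space set"
  assumes X: "open X" "bounded X" and \<epsilon>: "0 \<le> \<epsilon>"
  shows "{x \<in> X. \<epsilon> < infdist x (frontier X)} = erosion \<epsilon> X"
proof (intro equalityI subsetI)
  fix x assume "x \<in> {x \<in> X. \<epsilon> < infdist x (frontier X)}"
  then have x: "x \<in> X" "\<epsilon> < infdist x (frontier X)" by auto
  show "x \<in> erosion \<epsilon> X"
  proof (rule ccontr)
    assume "x \<notin> erosion \<epsilon> X"
    then have "cball x \<epsilon> - X \<noteq> {}" by (auto simp: erosion_def)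
    moreover have "x \<in> cball x \<epsilon> \<inter> X" using x \<epsilon> by simp
    ultimately have "cball x \<epsilon> \<inter> frontier X \<noteq> {}"
      by (intro connected_Int_frontier connected_cball) blast+
    then obtain z where "z \<in> frontier X" "dist x z \<le> \<epsilon>" by auto
    then show False using infdist_le[of z "frontier X" x] x(2) by simp
  qed
next
  fix x assume x: "x \<in> erosion \<epsilon> X"
  then have xX: "x \<in> X" using erosion_subset[OF \<epsilon>] by auto
  then have "frontier X \<noteq> {}" using bounded_frontier_nonempty X(2) by auto
  then obtain z where z: "z \<in> frontier X" "infdist x (frontier X) = dist x z"
    by (metis infdist_attains_inf frontier_closed)
  have "z \<notin> X" using z(1) X(1) frontier_disjoint_eq by blast
  then have "\<not> dist x z \<le> \<epsilon>" using x by (auto simp: erosion_def)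
  then show "x \<in> {x \<in> X. \<epsilon> < infdist x (frontier X)}" using xX z by simp
qed

lemma open_erosion:
  fixes X :: "'a::euclidean_space set"
  assumes X: "open X" "bounded X" and \<epsilon>: "0 \<le> \<epsilon>"
  shows "open (erosion \<epsilon> X)"
proof -
  have "open {x. \<epsilon> < infdist x (frontier X)}"
    by (intro open_Collect_less continuous_intros)
  then have "open (X \<inter> {x. \<epsilon> < infdist x (frontier X)})" using X(1) by blast
  then show ?thesis unfolding erosion_eq[OF assms, symmetric] Collect_conj_eq by simp
qed

lemma inner_parallel_volume_eq_erosion:
  fixes X :: "'a::euclidean_space set"
  assumes X: "open X" "bounded X" and \<epsilon>: "0 \<le> \<epsilon>"
  shows "inner_parallel_volume X \<epsilon> = measure lebesgue X - measure lebesgue (erosion \<epsilon> X)"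
proof -
  have "{x \<in> X. infdist x (frontier X) \<le> \<epsilon>} = X - erosion \<epsilon> X"
    unfolding erosion_eq[OF assms, symmetric] by auto
  then show ?thesis
    unfolding inner_parallel_volume_def
    using X open_erosion[OF assms] erosion_subset[OF \<epsilon>, of X]
    by (simp add: measurable_measure_Diff lmeasurable_open)
qed

lemma inner_parallel_volume_nonneg: "0 \<le> inner_parallel_volume X \<epsilon>"
  by (simp add: inner_parallel_volume_def)

lemma inner_parallel_volume_mono:
  fixes X :: "'a::euclidean_space set"
  assumes X: "open X" "bounded X"
  shows "mono (inner_parallel_volume X)"
proof (rule monoI)
  fix \<epsilon> \<epsilon>' :: real assume le: "\<epsilon> \<le> \<epsilon>'"
  show "inner_parallel_volume X \<epsilon> \<le> inner_parallel_volume X \<epsilon>'"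
  proof (cases "0 \<le> \<epsilon>")
    case True
    have "measure lebesgue (erosion \<epsilon>' X) \<le> measure lebesgue (erosion \<epsilon> X)"
    proof (rule measure_mono_fmeasurable[OF erosion_antimono[OF le]])
      have "open (erosion \<epsilon>' X)" using True le X by (intro open_erosion) auto
      then show "erosion \<epsilon>' X \<in> sets lebesgue" by simp
      show "erosion \<epsilon> X \<in> lmeasurable"
        using bounded_subset[OF X(2) erosion_subset[OF True]] open_erosion[OF X True]
        by (rule lmeasurable_open)
    qed
    then show ?thesis using True le X by (simp add: inner_parallel_volume_eq_erosion)
  next
    case False
    then have "{x \<in> X. infdist x (frontier X) \<le> \<epsilon>} = {}"
      using infdist_nonneg[of _ "frontier X"] by (auto simp: not_le intro: less_le_trans)
    then have "inner_parallel_volume X \<epsilon> = 0" by (simp only: inner_parallel_volume_def measure_empty)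
    then show ?thesis by (simp add: inner_parallel_volume_nonneg)
  qed
qed

lemma inner_parallel_volume_empty [simp]: "inner_parallel_volume {} \<epsilon> = 0"
  by (simp add: inner_parallel_volume_def)

lemma inner_parallel_volume_le_measure:
  fixes X :: "'a::euclidean_space set"
  assumes X: "open X" "bounded X"
  shows "inner_parallel_volume X \<epsilon> \<le> measure lebesgue X"
proof -
  have "inner_parallel_volume X \<epsilon> \<le> inner_parallel_volume X (max \<epsilon> 0)"
    using inner_parallel_volume_mono[OF X] by (auto simp: mono_def)
  also have "\<dots> \<le> measure lebesgue X" using X by (simp add: inner_parallel_volume_eq_erosion)
  finally show ?thesis .
qed

lemma inner_parallel_volume_eq_inradius:
  fixes X :: "'a::euclidean_space set"
  assumes X: "bounded X" and \<epsilon>: "inradius X \<le> \<epsilon>"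
  shows "inner_parallel_volume X \<epsilon> = inner_parallel_volume X (inradius X)"
proof -
  have "infdist x (frontier X) \<le> inradius X" if x: "x \<in> X" for x
    unfolding inradius_def
  proof (rule cSUP_upper[OF x])
    obtain z where z: "z \<in> frontier X" using bounded_frontier_nonempty X x by blast
    obtain M where M: "\<And>w. w \<in> X \<Longrightarrow> dist z w \<le> M" using X bounded_any_center by metis
    show "bdd_above ((\<lambda>x. infdist x (frontier X)) ` X)"
      using M infdist_le[OF z] by (intro bdd_aboveI2[of _ _ M]) (metis dist_commute order_trans)
  qed
  then have "{x \<in> X. infdist x (frontier X) \<le> \<epsilon>'} = X" if "inradius X \<le> \<epsilon>'" for \<epsilon>'
    using that by (auto intro: order_trans)
  then show ?thesis using \<epsilon> by (simp add: inner_parallel_volume_def)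
qed

lemma inner_parallel_volume_similarity:
  fixes f :: "'a::euclidean_space \<Rightarrow> 'a"
  assumes f: "similarity_with_ratio f c" "0 < c" and X: "open X" "bounded X" and \<epsilon>: "0 \<le> \<epsilon>"
  shows "inner_parallel_volume (f ` X) \<epsilon> = c ^ DIM('a) * inner_parallel_volume X (\<epsilon> / c)"
proof -
  have "erosion \<epsilon> (f ` X) = f ` erosion (\<epsilon> / c) X"
  proof -
    have e: "f x \<in> erosion \<epsilon> (f ` X) \<longleftrightarrow> x \<in> erosion (\<epsilon> / c) X" for x
    proof -
      have "cball (f x) \<epsilon> = f ` cball x (\<epsilon> / c)"
        using similarity_image_cball[OF f, of x "\<epsilon> / c"] f(2) by simp
      then show ?thesis by (simp add: erosion_def inj_image_subset_iff[OF similarity_inj[OF f]])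
    qed
    show ?thesis
    proof (intro equalityI subsetI)
      fix w assume "w \<in> erosion \<epsilon> (f ` X)"
      moreover obtain x where "w = f x" using similarity_surj[OF f] by (metis surj_def)
      ultimately show "w \<in> f ` erosion (\<epsilon> / c) X" using e by auto
    qed (use e in auto)
  qed
  moreover have "bounded (f ` X)"
  proof -
    obtain x M where "\<forall>z\<in>X. dist x z \<le> M" using X(2) bounded_def by blast
    then have "\<forall>z\<in>X. dist (f x) (f z) \<le> c * M" using f by (auto simp: similarity_with_ratio_def)
    then show ?thesis by (auto simp: bounded_def)
  qed
  ultimately show ?thesis
    using f X \<epsilon> measure_similarity_image[OF f] open_erosion[OF X, of "\<epsilon> / c"] similarity_open_image[OF f]
    by (simp add: inner_parallel_volume_eq_erosion right_diff_distrib)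
qed

text \<open>A ball contained in the union of two disjoint open sets is contained in one of them by connectedness;
therefore distances to the frontier may be computed in each part separately.\<close>

lemma inner_parallel_volume_Un:
  fixes X Y :: "'a::euclidean_space set"
  assumes X: "open X" "bounded X" and Y: "open Y" "bounded Y" and disj: "X \<inter> Y = {}" and \<epsilon>: "0 \<le> \<epsilon>"
  shows "inner_parallel_volume (X \<union> Y) \<epsilon> = inner_parallel_volume X \<epsilon> + inner_parallel_volume Y \<epsilon>"
proof -
  have "erosion \<epsilon> (X \<union> Y) = erosion \<epsilon> X \<union> erosion \<epsilon> Y"
  proof (intro equalityI subsetI)
    fix x assume "x \<in> erosion \<epsilon> (X \<union> Y)"
    then have "cball x \<epsilon> \<subseteq> X \<union> Y" by (simp add: erosion_def)
    then have "X \<inter> cball x \<epsilon> = {} \<or> Y \<inter> cball x \<epsilon> = {}"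
      using connectedD[OF connected_cball X(1) Y(1)] disj by blast
    with \<open>cball x \<epsilon> \<subseteq> X \<union> Y\<close> show "x \<in> erosion \<epsilon> X \<union> erosion \<epsilon> Y"
      by (auto simp: erosion_def)
  qed (auto simp: erosion_def)
  moreover have add: "measure lebesgue (P \<union> Q) = measure lebesgue P + measure lebesgue Q"
    if "open P" "open Q" "P \<subseteq> X" "Q \<subseteq> Y" for P Q
  proof -
    have "P \<in> lmeasurable" "Q \<in> lmeasurable"
      using that bounded_subset[OF X(2)] bounded_subset[OF Y(2)] by (auto intro!: lmeasurable_open)
    moreover have "P \<inter> Q = {}" using that disj by blast
    ultimately show ?thesis by (simp add: measure_Un3)
  qed
  ultimately show ?thesis
    using X Y \<epsilon> open_Un[OF X(1) Y(1)] add[of X Y] add[of "erosion \<epsilon> X" "erosion \<epsilon> Y"]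
    by (simp add: inner_parallel_volume_eq_erosion open_erosion erosion_subset)
qed

lemma inner_parallel_volume_UN:
  fixes X :: "'i \<Rightarrow> 'a::euclidean_space set"
  assumes "finite I" "\<And>i. i \<in> I \<Longrightarrow> open (X i)" "\<And>i. i \<in> I \<Longrightarrow> bounded (X i)"
    and "\<And>i j. i \<in> I \<Longrightarrow> j \<in> I \<Longrightarrow> i \<noteq> j \<Longrightarrow> X i \<inter> X j = {}" and \<epsilon>: "0 \<le> \<epsilon>"
  shows "inner_parallel_volume (\<Union>i\<in>I. X i) \<epsilon> = (\<Sum>i\<in>I. inner_parallel_volume (X i) \<epsilon>)"
  using assms(1-4)
proof (induction rule: finite_induct)
  case (insert i I)
  have "inner_parallel_volume (X i \<union> (\<Union>i\<in>I. X i)) \<epsilon>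
      = inner_parallel_volume (X i) \<epsilon> + inner_parallel_volume (\<Union>i\<in>I. X i) \<epsilon>"
  proof (rule inner_parallel_volume_Un[OF _ _ _ _ _ \<epsilon>])
    show "bounded (\<Union>i\<in>I. X i)" using insert by (intro bounded_UN) auto
    show "X i \<inter> (\<Union>i\<in>I. X i) = {}" using insert.prems(3)[of i] insert.hyps by blast
  qed (use insert.prems in auto)
  moreover have "inner_parallel_volume (\<Union>i\<in>I. X i) \<epsilon> = (\<Sum>i\<in>I. inner_parallel_volume (X i) \<epsilon>)"
    using insert.prems by (intro insert.IH) auto
  ultimately show ?case using insert.hyps by simp
qed simp

section \<open>The scaling equation of a self-similar tiling\<close>

context
  fixes N :: nat and S :: "nat \<Rightarrow> 'a::euclidean_space \<Rightarrow> 'a" and r :: "nat \<Rightarrow> real" and U :: "'a set"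
  assumes ifs: "similarity_ifs N S r" and feasible: "feasible_open_set N S U"
begin

lemma ifs_map:
  assumes "i \<in> {1..N}"
  shows "0 < r i" "r i < 1" "similarity_with_ratio (S i) (r i)"
  using ifs assms by (auto simp: similarity_ifs_def)

lemma tiling_Union_recursion:
  "\<Union> (self_similar_tiling N S U)
    = generator N S U \<union> (\<Union>i\<in>{1..N}. S i ` \<Union> (self_similar_tiling N S U))"
proof -
  have T: "\<Union> (self_similar_tiling N S U) = (\<Union>\<sigma>\<in>lists {1..N}. word_map S \<sigma> ` generator N S U)"
    by (auto simp: self_similar_tiling_def)
  have words: "lists {1..N} = insert [] (\<Union>i\<in>{1..N}. (#) i ` lists {1..N})" (is "?L = ?R")
  proof (intro equalityI subsetI)
    fix \<sigma> assume "\<sigma> \<in> ?L"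
    then show "\<sigma> \<in> ?R" by (cases \<sigma>) auto
  qed auto
  show ?thesis unfolding T by (subst words) (simp add: image_UN image_comp, blast)
qed

lemma word_map_image_subset: "\<sigma> \<in> lists {1..N} \<Longrightarrow> word_map S \<sigma> ` U \<subseteq> U"
proof (induction \<sigma>)
  case (Cons i \<sigma>)
  then have "word_map S \<sigma> ` U \<subseteq> U" "S i ` U \<subseteq> U"
    using feasible by (auto simp: feasible_open_set_def)
  then show ?case by (auto simp: image_comp[symmetric])
qed simp

lemma word_map_image_open: "\<sigma> \<in> lists {1..N} \<Longrightarrow> open X \<Longrightarrow> open (word_map S \<sigma> ` X)"
proof (induction \<sigma>)
  case (Cons i \<sigma>)
  then have "open (S i ` word_map S \<sigma> ` X)"
    using ifs_map[of i] by (intro similarity_open_image[of "S i" "r i"]) auto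
  then show ?case by (simp add: image_comp)
qed simp

lemma open_generator: "open (generator N S U)"
proof -
  have "compact (closure U)" using feasible by (simp add: feasible_open_set_def)
  then have "closed (S i ` closure U)" if "i \<in> {1..N}" for i
    using similarity_continuous[OF ifs_map(3,1)[OF that]]
    by (intro compact_imp_closed compact_continuous_image)
  then have "closed (ifs_image N S (closure U))"
    unfolding ifs_image_def by (intro closed_UN) auto
  then show ?thesis using feasible by (auto simp: generator_def feasible_open_set_def)
qed

lemma generator_subset: "generator N S U \<subseteq> U"
  by (auto simp: generator_def)

lemma tiling_Union_subset: "\<Union> (self_similar_tiling N S U) \<subseteq> U"
  using word_map_image_subset generator_subset by (fastforce simp: self_similar_tiling_def)

lemma open_tiling_Union: "open (\<Union> (self_similar_tiling N S U))"
  using word_map_image_open[OF _ open_generator] by (auto simp: self_similar_tiling_def)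

lemma bounded_generator: "bounded (generator N S U)"
  and bounded_tiling_Union: "bounded (\<Union> (self_similar_tiling N S U))"
  using feasible bounded_subset generator_subset tiling_Union_subset
  by (auto simp: feasible_open_set_def)

text \<open>The sets \<open>S i ` T\<close> are disjoint because they lie in the disjoint sets \<open>S i ` U\<close>, and they miss the
generator because it avoids \<open>S i ` closure U\<close>.\<close>

lemma tiling_parallel_volume_recursion:
  assumes \<epsilon>: "0 \<le> \<epsilon>"
  shows "inner_parallel_volume (\<Union> (self_similar_tiling N S U)) \<epsilon>
    = inner_parallel_volume (generator N S U) \<epsilon>
      + (\<Sum>i=1..N. r i ^ DIM('a) * inner_parallel_volume (\<Union> (self_similar_tiling N S U)) (\<epsilon> / r i))"
proof -
  define T where "T = \<Union> (self_similar_tiling N S U)"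
  have T: "open T" "bounded T" "T \<subseteq> U"
    using open_tiling_Union bounded_tiling_Union tiling_Union_subset by (auto simp: T_def)
  have sub: "S i ` T \<subseteq> S i ` U" "S i ` T \<subseteq> U" if "i \<in> {1..N}" for i
  proof -
    show "S i ` T \<subseteq> S i ` U" using T(3) by blast
    also have "S i ` U \<subseteq> U" using feasible that by (simp add: feasible_open_set_def)
    finally show "S i ` T \<subseteq> U" .
  qed
  have op: "open (S i ` T)" if "i \<in> {1..N}" for i
    by (rule similarity_open_image[OF ifs_map(3,1)[OF that] T(1)])
  have bd: "bounded (S i ` T)" if "i \<in> {1..N}" for i
    using sub(2)[OF that] feasible bounded_subset by (auto simp: feasible_open_set_def)
  have "inner_parallel_volume T \<epsilon> = inner_parallel_volume (generator N S U \<union> (\<Union>i\<in>{1..N}. S i ` T)) \<epsilon>"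
    using tiling_Union_recursion by (simp add: T_def)
  also have "\<dots> = inner_parallel_volume (generator N S U) \<epsilon> + inner_parallel_volume (\<Union>i\<in>{1..N}. S i ` T) \<epsilon>"
  proof (rule inner_parallel_volume_Un[OF open_generator bounded_generator _ _ _ \<epsilon>])
    show "open (\<Union>i\<in>{1..N}. S i ` T)" using op by blast
    show "bounded (\<Union>i\<in>{1..N}. S i ` T)" using bd by (intro bounded_UN) auto
    show "generator N S U \<inter> (\<Union>i\<in>{1..N}. S i ` T) = {}"
      using T(3) closure_subset[of U] by (fastforce simp: generator_def ifs_image_def)
  qed
  also have "inner_parallel_volume (\<Union>i\<in>{1..N}. S i ` T) \<epsilon> = (\<Sum>i=1..N. inner_parallel_volume (S i ` T) \<epsilon>)"
  proof (rule inner_parallel_volume_UN[OF _ op bd _ \<epsilon>])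
    fix i j assume ij: "i \<in> {1..N}" "j \<in> {1..N}" "i \<noteq> j"
    then have "S i ` U \<inter> S j ` U = {}" using feasible by (simp add: feasible_open_set_def)
    then show "S i ` T \<inter> S j ` T = {}" using sub(1)[OF ij(1)] sub(1)[OF ij(2)] by blast
  qed auto
  also have "\<dots> = (\<Sum>i=1..N. r i ^ DIM('a) * inner_parallel_volume T (\<epsilon> / r i))"
  proof (rule sum.cong[OF refl])
    fix i assume "i \<in> {1..N}"
    then show "inner_parallel_volume (S i ` T) \<epsilon> = r i ^ DIM('a) * inner_parallel_volume T (\<epsilon> / r i)"
      by (intro inner_parallel_volume_similarity ifs_map T \<epsilon>)
  qed
  finally show ?thesis unfolding T_def .
qed

end

section \<open>The tail integral of a pluriphase generator\<close>

lemma sum_by_parts: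
  fixes a E :: "nat \<Rightarrow> real"
  assumes "1 \<le> m" "E 0 = 0"
  shows "(\<Sum>l=1..m. a l * (E l - E (l - 1))) = (\<Sum>l=1..m-1. (a l - a (l + 1)) * E l) + a m * E m"
  using assms(1)
proof (induction m rule: dec_induct)
  case base
  then show ?case using assms(2) by simp
next
  case (step n)
  define X where "X = (\<Sum>l=1..n-1. (a l - a (l + 1)) * E l)"
  have IH: "(\<Sum>l=1..n. a l * (E l - E (l - 1))) = X + a n * E n"
    unfolding X_def by (rule step.IH)
  have "{1..Suc n - 1} = insert n {1..n - 1}" using step(1) by auto
  then have "(\<Sum>l=1..Suc n - 1. (a l - a (l + 1)) * E l) = (a n - a (n + 1)) * E n + X"
    using step(1) by (simp add: X_def)
  moreover have "(\<Sum>l=1..Suc n. a l * (E l - E (l - 1))) = X + a n * E n + a (Suc n) * (E (Suc n) - E n)"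
    using IH by simp
  moreover have "X + a n * E n + a (Suc n) * (E (Suc n) - E n)
      = (a n - a (n + 1)) * E n + X + a (Suc n) * E (Suc n)" by (simp add: algebra_simps)
  ultimately show ?case by (simp only:)
qed

lemma tail_integral_eventually_constant:
  assumes c: "0 < c" and g: "0 < g" and const: "\<And>\<epsilon>. g < \<epsilon> \<Longrightarrow> v \<epsilon> = w"
  shows "tail_integral c v g = w * g powr - c / c"
proof -
  have "tail_integral c v g = (LBINT \<epsilon>:{g<..}. w * \<epsilon> powr (- c - 1))"
    unfolding tail_integral_def using const g
    by (intro set_lebesgue_integral_cong) (auto simp: powr_diff)
  then show ?thesis using set_integral_powr_Ioi(2)[OF g c] by simp
qed

text \<open>On the \<open>l\<close>-th phase the integrand has the primitive \<open>P l\<close>, a combination of the powers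
\<open>x powr (D - k)\<close>. All their exponents are positive, so \<open>P 1\<close> vanishes at \<open>0\<close> and the integral
converges there. The jumps of the primitive at the phase boundaries produce, by summation by parts, the
differences of coefficients, and the constant tail beyond the last boundary produces the last term.\<close>

lemma tail_integral_pluriphase_limit:
  fixes d m :: nat and c D B :: real and v :: "real \<Rightarrow> real" and e :: "nat \<Rightarrow> real"
    and \<kappa> :: "nat \<Rightarrow> nat \<Rightarrow> real"
  assumes c: "0 < c" and v: "mono v" "\<And>x. 0 \<le> v x" "\<And>x. v x \<le> B"
    and D: "D = real d - c" "real d - 1 < D"
    and m: "1 \<le> m" and e: "e 0 = 0" "strict_mono_on {0..m} e"
    and phase: "\<And>l \<epsilon>. l \<in> {1..m} \<Longrightarrow> \<epsilon> \<in> {e (l - 1)<..e l} \<Longrightarrow> v \<epsilon> = (\<Sum>k<d. \<kappa> k l * \<epsilon> ^ (d - k))"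
    and const: "\<And>\<epsilon>. e m \<le> \<epsilon> \<Longrightarrow> v \<epsilon> = v (e m)"
  shows "(tail_integral c v \<longlongrightarrow>
      (\<Sum>k<d. 1 / (D - real k) * ((\<Sum>l=1..m-1. (\<kappa> k l - \<kappa> k (l + 1)) * e l powr (D - real k)) +
        (real d - real k) / (real d - D) * \<kappa> k m * e m powr (D - real k)))) (at_right 0)"
proof -
  define P where "P = (\<lambda>l x. \<Sum>k<d. \<kappa> k l * x powr (D - real k) / (D - real k))"
  have Dk: "0 < D - real k" if "k < d" for k using that D(2) by simp
  have e_mono: "e i < e j" if "i < j" "j \<le> m" for i j
    using e(2) that by (auto simp: strict_mono_on_def)
  have e_pos: "0 < e l" if "1 \<le> l" "l \<le> m" for l using e_mono[of 0 l] that e(1) by simp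
  have piece: "tail_integral c v a - tail_integral c v b = P l b - P l a"
    if "0 < a" "a \<le> b" "e (l - 1) \<le> a" "b \<le> e l" "l \<in> {1..m}" for a b l
  proof -
    have "\<epsilon> powr - c * v \<epsilon> / \<epsilon> = (\<Sum>k<d. \<kappa> k l * \<epsilon> powr (D - real k - 1))" if \<epsilon>: "\<epsilon> \<in> {a<..b}" for \<epsilon>
    proof -
      have "0 < \<epsilon>" using \<epsilon> \<open>0 < a\<close> by simp
      have "\<epsilon> powr - c * (\<kappa> k l * \<epsilon> ^ (d - k)) / \<epsilon> = \<kappa> k l * \<epsilon> powr (D - real k - 1)" if "k < d" for k
      proof -
        have "D - real k - 1 = - c + real (d - k) - 1" using that D(1) by (simp add: of_nat_diff)
        then have "\<epsilon> powr (D - real k - 1) = \<epsilon> powr (- c + real (d - k) - 1)" by (simp only:)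
        also have "\<dots> = \<epsilon> powr - c * \<epsilon> ^ (d - k) / \<epsilon>"
          using \<open>0 < \<epsilon>\<close> by (simp only: powr_diff powr_add powr_realpow powr_one)
        finally show ?thesis by simp
      qed
      moreover have "v \<epsilon> = (\<Sum>k<d. \<kappa> k l * \<epsilon> ^ (d - k))"
        using \<epsilon> \<open>e (l - 1) \<le> a\<close> \<open>b \<le> e l\<close> \<open>l \<in> {1..m}\<close> by (intro phase) auto
      ultimately show ?thesis by (simp add: sum_distrib_left sum_divide_distrib)
    qed
    then have "(LBINT \<epsilon>:{a<..b}. \<epsilon> powr - c * v \<epsilon> / \<epsilon>)
        = (LBINT \<epsilon>:{a<..b}. \<Sum>k<d. \<kappa> k l * \<epsilon> powr (D - real k - 1))"
      by (intro set_lebesgue_integral_cong) auto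
    also have "\<dots> = (\<Sum>k<d. LBINT \<epsilon>:{a<..b}. \<kappa> k l * \<epsilon> powr (D - real k - 1))"
      using Dk that(1,2) by (intro set_integral_sum(2) set_integral_powr_Ioc(1)) force+
    also have "\<dots> = (\<Sum>k<d. \<kappa> k l * (b powr (D - real k) - a powr (D - real k)) / (D - real k))"
      using Dk that(1,2) by (intro sum.cong refl set_integral_powr_Ioc(2)) force+
    also have "\<dots> = P l b - P l a"
      by (simp add: P_def sum_subtractf[symmetric] right_diff_distrib diff_divide_distrib)
    finally show ?thesis using tail_integral_diff[OF c v that(1,2)] by simp
  qed
  have telescope: "tail_integral c v (e 1) - tail_integral c v (e n) + (P 1 (e 1) - P 1 (e 0))
      = (\<Sum>l=1..n. P l (e l) - P l (e (l - 1)))" if "1 \<le> n" "n \<le> m" for n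
    using that
  proof (induction n rule: dec_induct)
    case (step n)
    have "tail_integral c v (e n) - tail_integral c v (e (Suc n)) = P (Suc n) (e (Suc n)) - P (Suc n) (e n)"
      using step(1,4) e_pos[of n] e_mono[of n "Suc n"] by (intro piece) auto
    then show ?case using step(3,4) by simp
  qed simp
  define g where "g = e m"
  have g: "0 < g" using e_pos[of m] m by (simp add: g_def)
  have "((\<lambda>x. P 1 x) \<longlongrightarrow> P 1 (e 0)) (at_right 0)"
  proof -
    have "((\<lambda>x. \<kappa> k 1 * x powr (D - real k) / (D - real k))
        \<longlongrightarrow> \<kappa> k 1 * 0 powr (D - real k) / (D - real k)) (at_right 0)" if "k < d" for k
      using Dk[OF that]
      by (intro tendsto_intros tendsto_powr2)
         (auto simp: eventually_at_filter)
    then show ?thesis unfolding P_def e(1) by (intro tendsto_sum) auto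
  qed
  then have "((\<lambda>x. P 1 (e 1) - P 1 x + tail_integral c v (e 1))
      \<longlongrightarrow> P 1 (e 1) - P 1 (e 0) + tail_integral c v (e 1)) (at_right 0)"
    by (intro tendsto_intros)
  then have lim: "(tail_integral c v \<longlongrightarrow> P 1 (e 1) - P 1 (e 0) + tail_integral c v (e 1)) (at_right 0)"
  proof (rule Lim_transform_eventually)
    have "eventually (\<lambda>x. x \<in> {0<..<e 1}) (at_right 0)"
      by (rule eventually_at_right_real) (use e_pos[of 1] m in auto)
    then show "eventually (\<lambda>x. P 1 (e 1) - P 1 x + tail_integral c v (e 1) = tail_integral c v x) (at_right 0)"
    proof eventually_elim
      case (elim x)
      then have "tail_integral c v x - tail_integral c v (e 1) = P 1 (e 1) - P 1 x"
        using m e(1) by (intro piece) auto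
      then show ?case by simp
    qed
  qed
  have "P 1 (e 1) - P 1 (e 0) + tail_integral c v (e 1)
      = (\<Sum>l=1..m. P l (e l) - P l (e (l - 1))) + tail_integral c v g"
    using telescope[OF m order_refl] by (simp add: g_def)
  also have "(\<Sum>l=1..m. P l (e l) - P l (e (l - 1)))
      = (\<Sum>l=1..m. \<Sum>k<d. \<kappa> k l * (e l powr (D - real k) - e (l - 1) powr (D - real k)) / (D - real k))"
    by (simp add: P_def sum_subtractf[symmetric] right_diff_distrib diff_divide_distrib)
  also have "\<dots> = (\<Sum>k<d. \<Sum>l=1..m. \<kappa> k l * (e l powr (D - real k) - e (l - 1) powr (D - real k)) / (D - real k))"
    by (rule sum.swap)
  also have "\<dots> = (\<Sum>k<d. 1 / (D - real k) * ((\<Sum>l=1..m-1. (\<kappa> k l - \<kappa> k (l + 1)) * e l powr (D - real k))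
      + \<kappa> k m * g powr (D - real k)))"
    using sum_by_parts[of m "\<lambda>l. e l powr (D - real k)" "\<kappa> k" for k] m e(1)
    by (simp add: g_def sum_divide_distrib[symmetric])
  also have "tail_integral c v g = (\<Sum>k<d. \<kappa> k m * g powr (D - real k) / c)"
  proof -
    have "tail_integral c v g = v g * g powr - c / c"
      unfolding g_def by (rule tail_integral_eventually_constant[OF c g[unfolded g_def] const]) simp
    also have "v g = (\<Sum>k<d. \<kappa> k m * g ^ (d - k))"
      unfolding g_def using m e_mono[of "m - 1" m] by (intro phase) auto
    also have "\<dots> * g powr - c / c = (\<Sum>k<d. \<kappa> k m * g powr (D - real k) / c)"
    proof -
      have "g ^ (d - k) * g powr - c = g powr (D - real k)" if "k < d" for k
      proof -
        have "D - real k = real (d - k) + - c" using that D(1) by (simp add: of_nat_diff)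
        then show ?thesis using g by (simp only: powr_add powr_realpow)
      qed
      then show ?thesis by (simp add: sum_distrib_right sum_divide_distrib mult.assoc)
    qed
    finally show ?thesis .
  qed
  also have "(\<Sum>k<d. 1 / (D - real k) * ((\<Sum>l=1..m-1. (\<kappa> k l - \<kappa> k (l + 1)) * e l powr (D - real k))
        + \<kappa> k m * g powr (D - real k))) + (\<Sum>k<d. \<kappa> k m * g powr (D - real k) / c)
      = (\<Sum>k<d. 1 / (D - real k) * ((\<Sum>l=1..m-1. (\<kappa> k l - \<kappa> k (l + 1)) * e l powr (D - real k)) +
        (real d - real k) / (real d - D) * \<kappa> k m * e m powr (D - real k)))"
    unfolding sum.distrib[symmetric] g_def[symmetric]
  proof (rule sum.cong[OF refl])
    fix k assume "k \<in> {..<d}"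
    \<comment> \<open>\<open>s = D - k\<close>: the last phase and the constant tail have the common factor
      \<open>1 / s + 1 / c = (s + c) / (s * c)\<close>.\<close>
    have combine: "1 / s * (X + Y) + Y / c = 1 / s * (X + (s + c) / c * Y)" if "0 < s" for s X Y
      using that c by (simp add: field_simps)
    have "real d - real k = (D - real k) + c" "real d - D = c" using D(1) by auto
    then show "1 / (D - real k) * ((\<Sum>l=1..m-1. (\<kappa> k l - \<kappa> k (l + 1)) * e l powr (D - real k))
        + \<kappa> k m * g powr (D - real k)) + \<kappa> k m * g powr (D - real k) / c
      = 1 / (D - real k) * ((\<Sum>l=1..m-1. (\<kappa> k l - \<kappa> k (l + 1)) * e l powr (D - real k)) +
        (real d - real k) / (real d - D) * \<kappa> k m * g powr (D - real k))"
      using combine[OF Dk, of k] \<open>k \<in> {..<d}\<close> by (simp only: lessThan_iff mult.assoc)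
  qed
  finally show ?thesis using lim by simp
qed

section \<open>Minkowski contents of self-similar tilings\<close>

lemma group_closure_uminus_image: "group_closure (uminus ` X) = group_closure (X :: real set)"
proof -
  have *: "group_closure (uminus ` X) \<subseteq> group_closure X" for X :: "real set"
  proof
    fix s assume "s \<in> group_closure (uminus ` X)"
    then show "s \<in> group_closure X"
      by induction (auto intro: group_closure.intros)
  qed
  from *[of X] *[of "uminus ` X"] show ?thesis by (simp add: image_comp)
qed

theorem corollary3p9:
  fixes N m :: nat
    and S :: "nat \<Rightarrow> 'a::euclidean_space \<Rightarrow> 'a"
    and r e :: "nat \<Rightarrow> real"
    and D :: real
    and U :: "'a set"
    and \<kappa> :: "nat \<Rightarrow> nat \<Rightarrow> real"
  assumes "similarity_ifs N S r"
    and "(\<Sum>i=1..N. r i powr D) = 1"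
    and "feasible_open_set N S U"
    and "D < real DIM('a)"
    and "D > real DIM('a) - 1"
    and "pluriphase_with (generator N S U) m e \<kappa>"
  shows "let d = DIM('a);
             g = inradius (generator N S U);
             \<eta> = - (\<Sum>i=1..N. r i powr D * ln (r i));
             M = 1 / \<eta> * (\<Sum>k<d. 1 / (D - real k) *
                   ((\<Sum>l=1..m-1. (\<kappa> k l - \<kappa> k (l + 1)) * e l powr (D - real k)) +
                    (real d - real k) / (real d - D) * \<kappa> k m * g powr (D - real k)))
         in has_average_minkowski_content D (self_similar_tiling N S U) M \<and>
            (nonlattice N r \<longrightarrow> has_minkowski_content D (self_similar_tiling N S U) M)"
proof -
  let ?d = "DIM('a)"
  let ?C = "\<Sum>k<?d. 1 / (D - real k) *
    ((\<Sum>l=1..m-1. (\<kappa> k l - \<kappa> k (l + 1)) * e l powr (D - real k)) +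
     (real ?d - real k) / (real ?d - D) * \<kappa> k m * inradius (generator N S U) powr (D - real k))"
  define T where "T = \<Union> (self_similar_tiling N S U)"
  define G where "G = generator N S U"
  define c where "c = real ?d - D"
  define V where "V = inner_parallel_volume T"
  define v where "v = inner_parallel_volume G"
  define B where "B = measure lebesgue T + measure lebesgue G"
  have c: "0 < c" using assms(4) by (simp add: c_def)
  have T: "open T" "bounded T" and G: "open G" "bounded G"
    using open_tiling_Union bounded_tiling_Union open_generator bounded_generator assms(1,3)
    by (auto simp: T_def G_def)
  have V: "mono V" "\<And>x. 0 \<le> V x" "\<And>x. V x \<le> B" and v: "mono v" "\<And>x. 0 \<le> v x" "\<And>x. v x \<le> B"
    unfolding V_def v_def B_def
    by (rule inner_parallel_volume_mono[OF T] inner_parallel_volume_mono[OF G] inner_parallel_volume_nonneg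
        add_increasing2[OF measure_nonneg inner_parallel_volume_le_measure[OF T]]
        add_increasing[OF measure_nonneg inner_parallel_volume_le_measure[OF G]])+
  have ratio: "0 < r i" "r i < 1" if "i \<in> {1..N}" for i
    using ifs_map[OF assms(1,3) that] by auto
  note pluri = assms(6)[folded G_def, unfolded pluriphase_with_def]
  have e: "1 \<le> m" "e 0 = 0" "strict_mono_on {0..m} e" and g: "e m = inradius G"
    and phase: "\<And>l \<epsilon>. l \<in> {1..m} \<Longrightarrow> \<epsilon> \<in> {e (l - 1)<..e l} \<Longrightarrow> v \<epsilon> = (\<Sum>k<?d. \<kappa> k l * \<epsilon> ^ (?d - k))"
    using pluri unfolding v_def by blast+
  have const: "v \<epsilon> = v (e m)" if "e m \<le> \<epsilon>" for \<epsilon>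
    using that unfolding v_def g by (rule inner_parallel_volume_eq_inradius[OF G(2)])
  have Dc: "D = real ?d - c" by (simp add: c_def)
  have limit: "(tail_integral c v \<longlongrightarrow> ?C) (at_right 0)"
    unfolding g[unfolded G_def, symmetric]
    by (rule tail_integral_pluriphase_limit[OF c v Dc assms(5) e phase const])
  have scaling: "V x = v x + (\<Sum>i=1..N. r i powr (D + c) * V (x / r i))" if "0 < x" for x
  proof -
    have "(\<Sum>i=1..N. r i ^ ?d * V (x / r i)) = (\<Sum>i=1..N. r i powr (D + c) * V (x / r i))"
    proof (rule sum.cong[OF refl])
      fix i assume "i \<in> {1..N}"
      then show "r i ^ ?d * V (x / r i) = r i powr (D + c) * V (x / r i)"
        using ratio(1)[of i] by (simp add: c_def powr_realpow)
    qed
    moreover have "V x = v x + (\<Sum>i=1..N. r i ^ ?d * V (x / r i))"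
      unfolding V_def v_def T_def G_def
      by (rule tiling_parallel_volume_recursion[OF assms(1,3)]) (use that in simp)
    ultimately show ?thesis by (simp only:)
  qed
  interpret scaling_renewal "{1..N}" r D c B ?C V v
    by unfold_locales (rule finite_atLeastAtMost ratio assms(2) c V v scaling limit | assumption)+
  have mean: "mean = - (\<Sum>i=1..N. r i powr D * ln (r i))"
    unfolding mean_def by (simp add: sum_negf)
  have "has_average_minkowski_content D (self_similar_tiling N S U) (1 / mean * ?C)"
    using average_limit by (simp add: has_average_minkowski_content_def c_def V_def T_def)
  moreover have "has_minkowski_content D (self_similar_tiling N S U) (1 / mean * ?C)" if "nonlattice N r"
  proof -
    have "(\<lambda>i. - ln (r i)) ` {1..N} = uminus ` (\<lambda>i. ln (r i)) ` {1..N}" by (simp add: image_comp)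
    then have "\<not> discrete (group_closure ((\<lambda>i. - ln (r i)) ` {1..N}))"
      using that by (simp add: nonlattice_def group_closure_uminus_image)
    from nonlattice_limit[OF this] show ?thesis
      by (simp add: has_minkowski_content_def c_def V_def T_def)
  qed
  ultimately show ?thesis unfolding Let_def mean by blast
qed

end
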